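(* Let $(A,\Phi)$ be an $\ell$EAS and let $V$ be a nonzero vector space. Consider the associative algebra $(T_A(V)\otimes A,\star)$. 1. The following conditions are equivalent: (a) The associative algebra $T_A(V)\otimes A$ is generated by $V\otimes A$. (b) $\Phi$ is surjective. 2. The following conditions are equivalent: (a) The subalgebra of $T_A(V)\otimes A$ generated by $V\otimes A$ is free. (b) $\Phi$ is injective.
   Context: All vector spaces are over a field $\mathbb{K}$; associative algebras are nonunital, and "free" means free as a nonunital associative algebra (isomorphic to $\bigoplus_{n\geqslant1}U^{\otimes n}$ for some vector space $U$). Sweedler-like notation: $\Phi(a\otimes b)=\sum a'\rightarrow b'\otimes a''\triangleright b''$ (purely symbolic), for a linear map $\Phi:A\otimes A\to A\otimes A$. $(A,\Phi)$ is an $\ell$EAS if $(\mathrm{Id}\otimes\Phi)\circ(\Phi\otimes\mathrm{Id})\circ(\mathrm{Id}\otimes\Phi)=(\Phi\otimes\mathrm{Id})\circ(\mathrm{Id}\otimes\tau)\circ(\Phi\otimes\mathrm{Id})$ on $A^{\otimes 3}$, where $\tau(a\otimes b)=b\otimes a$. $T_A(V)=\bigoplus_{n\geqslant 1}A^{\otimes(n-1)}\otimes V^{\otimes n}$, with tensors written $a_1\ldots a_{n-1}x_1\ldots x_n$ (a word of length $n$); $\cdot:T_A(V)\otimes A\otimes V\to T_A(V)$ is given by $a_1\ldots a_{n-1}x_1\ldots x_n\cdot ax=a_1\ldots a_{n-1}a\,x_1\ldots x_nx$; products $*_a$ ($a\in A$) on $T_A(V)$ are defined by induction on the length of the right factor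 by $w*_az=w\cdot az$ and $u*_a(v\cdot bz)=\sum(u*_{a''\triangleright b''}v)\cdot(a'\rightarrow b')z$ for $u,v,w\in T_A(V)$, $z\in V$, $a,b\in A$. The (associative) product $\star$ on $T_A(V)\otimes A$ is $(u\otimes a)\star(v\otimes b)=\sum(u*_{a''\triangleright b''}v)\otimes(a'\rightarrow b')$. $V\otimes A$ is a subspace of $T_A(V)\otimes A$ since $V$ is the length-one component of $T_A(V)$. *)

theory Defs
  imports Complex_Main "HOL-Library.Poly_Mapping"
begin

section \<open>Vector spaces given by generators and relations\<close>

text \<open>The free vector space on a type of generators is the type of finitely supported functions;
  \<open>single x c\<close> is \<open>c\<close> times the generator \<open>x\<close>.\<close>

definition free_scale :: "'k::field \<Rightarrow> ('x \<Rightarrow>\<^sub>0 'k) \<Rightarrow> ('x \<Rightarrow>\<^sub>0 'k)" where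
  "free_scale c p = Poly_Mapping.map ((*) c) p"

lemma lookup_free_scale [simp]:
  "Poly_Mapping.lookup (free_scale c p) x = c * Poly_Mapping.lookup p x"
  by (simp add: free_scale_def Poly_Mapping.map.rep_eq when_def)

lemma vector_space_free_scale: "vector_space free_scale"
  by unfold_locales
    (auto intro!: poly_mapping_eqI simp: lookup_add algebra_simps)

definition lincomb ::
    "('k::field \<Rightarrow> 'v::ab_group_add \<Rightarrow> 'v) \<Rightarrow> ('x \<Rightarrow> 'v) \<Rightarrow> ('x \<Rightarrow>\<^sub>0 'k) \<Rightarrow> 'v" where
  "lincomb s g p = (\<Sum>x\<in>Poly_Mapping.keys p. s (Poly_Mapping.lookup p x) (g x))"

text \<open>\<open>presents s S X g R\<close>: the linear map from the free vector space on \<open>X\<close> sending each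
  generator \<open>x\<close> to \<open>g x\<close> induces an isomorphism from the quotient by the span of \<open>R\<close> onto the
  subspace \<open>S\<close>. Tensor products are determined only up to unique isomorphism, so each of
  them is described below as any vector space presented by its usual generators and relations.\<close>

definition presents ::
    "('k::field \<Rightarrow> 'v::ab_group_add \<Rightarrow> 'v) \<Rightarrow> 'v set \<Rightarrow> 'x set \<Rightarrow> ('x \<Rightarrow> 'v)
      \<Rightarrow> ('x \<Rightarrow>\<^sub>0 'k) set \<Rightarrow> bool" where
  "presents s S X g R \<longleftrightarrow>
     vector_space s \<and>
     lincomb s g ` {p. Poly_Mapping.keys p \<subseteq> X} = S \<and>
     {p. Poly_Mapping.keys p \<subseteq> X \<and> lincomb s g p = 0} = module.span free_scale R"

text \<open>The relations making a generator \<open>h u\<close> linear in its argument \<open>u \<in> U\<close>; multilinearity is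
  expressed by taking the union over all slots \<open>h\<close>.\<close>

definition slot_relations ::
    "('k::field \<Rightarrow> 'u::ab_group_add \<Rightarrow> 'u) \<Rightarrow> 'u set \<Rightarrow> ('u \<Rightarrow> 'x) \<Rightarrow> ('x \<Rightarrow>\<^sub>0 'k) set" where
  "slot_relations s U h =
     {Poly_Mapping.single (h (u + v)) 1 - Poly_Mapping.single (h u) 1
        - Poly_Mapping.single (h v) 1 | u v. u \<in> U \<and> v \<in> U} \<union>
     {Poly_Mapping.single (h (s c u)) 1 - Poly_Mapping.single (h u) c | c u. u \<in> U}"

text \<open>The linear map on a presented space with prescribed values \<open>f x\<close> on the generators \<open>g x\<close>,
  \<open>x \<in> X\<close> (it is unique, and exists if and only if \<open>f\<close> respects the relations).\<close>

definition linear_extension ::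
    "('k::field \<Rightarrow> 'd::ab_group_add \<Rightarrow> 'd) \<Rightarrow> 'x set \<Rightarrow> ('x \<Rightarrow> 'd)
      \<Rightarrow> ('k \<Rightarrow> 'c::ab_group_add \<Rightarrow> 'c) \<Rightarrow> ('x \<Rightarrow> 'c) \<Rightarrow> 'd \<Rightarrow> 'c" where
  "linear_extension sD X g sC f =
     (THE L. Vector_Spaces.linear sD sC L \<and> (\<forall>x\<in>X. L (g x) = f x))"


section \<open>Tensor products\<close>

definition tensor_product ::
    "('k::field \<Rightarrow> 'a::ab_group_add \<Rightarrow> 'a) \<Rightarrow> ('k \<Rightarrow> 'b::ab_group_add \<Rightarrow> 'b)
      \<Rightarrow> ('k \<Rightarrow> 'ab::ab_group_add \<Rightarrow> 'ab) \<Rightarrow> ('a \<times> 'b \<Rightarrow> 'ab) \<Rightarrow> bool" where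
  "tensor_product sA sB sAB t \<longleftrightarrow>
     presents sAB UNIV UNIV t
       ((\<Union>b. slot_relations sA UNIV (\<lambda>a. (a, b))) \<union>
        (\<Union>a. slot_relations sB UNIV (\<lambda>b. (a, b))))"

definition tensor_cube ::
    "('k::field \<Rightarrow> 'a::ab_group_add \<Rightarrow> 'a) \<Rightarrow> ('k \<Rightarrow> 'c::ab_group_add \<Rightarrow> 'c)
      \<Rightarrow> ('a \<times> 'a \<times> 'a \<Rightarrow> 'c) \<Rightarrow> bool" where
  "tensor_cube sA sC t \<longleftrightarrow>
     presents sC UNIV UNIV t
       ((\<Union>b c. slot_relations sA UNIV (\<lambda>a. (a, b, c))) \<union>
        (\<Union>a c. slot_relations sA UNIV (\<lambda>b. (a, b, c))) \<union>
        (\<Union>a b. slot_relations sA UNIV (\<lambda>c. (a, b, c))))"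

text \<open>The pair \<open>([a\<^sub>1, \<dots>, a\<^sub>n\<^sub>-\<^sub>1], [x\<^sub>1, \<dots>, x\<^sub>n])\<close> stands for the tensor
  \<open>a\<^sub>1 \<dots> a\<^sub>n\<^sub>-\<^sub>1 x\<^sub>1 \<dots> x\<^sub>n\<close>. No relation mixes words of different lengths,
  so the space presented by all words is the direct sum over \<open>n \<ge> 1\<close>.\<close>

definition TAV_words :: "('a list \<times> 'v list) set" where
  "TAV_words = {(as, xs). length xs = Suc (length as)}"

definition TAV ::
    "('k::field \<Rightarrow> 'a::ab_group_add \<Rightarrow> 'a) \<Rightarrow> ('k \<Rightarrow> 'v::ab_group_add \<Rightarrow> 'v)
      \<Rightarrow> ('k \<Rightarrow> 't::ab_group_add \<Rightarrow> 't) \<Rightarrow> ('a list \<times> 'v list \<Rightarrow> 't) \<Rightarrow> bool" where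
  "TAV sA sV sT w \<longleftrightarrow>
     presents sT UNIV TAV_words w
       (\<Union>{slot_relations sA UNIV (\<lambda>a. (as @ a # bs, xs)) | as bs xs.
            length xs = length as + length bs + 2} \<union>
        \<Union>{slot_relations sV UNIV (\<lambda>x. (as, xs @ x # ys)) | as xs ys.
            length as = length xs + length ys})"


section \<open>The defining equation of an lEAS\<close>

definition Id_tensor ::
    "('k::field \<Rightarrow> 'aa::ab_group_add \<Rightarrow> 'aa) \<Rightarrow> ('a \<times> 'a \<Rightarrow> 'aa)
      \<Rightarrow> ('k \<Rightarrow> 'aaa::ab_group_add \<Rightarrow> 'aaa) \<Rightarrow> ('a \<times> 'a \<times> 'a \<Rightarrow> 'aaa)
      \<Rightarrow> ('aa \<Rightarrow> 'aa) \<Rightarrow> 'aaa \<Rightarrow> 'aaa" where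
  "Id_tensor sAA tAA sA3 tA3 \<Phi> =
     linear_extension sA3 UNIV tA3 sA3
       (\<lambda>(a, b, c). linear_extension sAA UNIV tAA sA3 (\<lambda>(d, e). tA3 (a, d, e)) (\<Phi> (tAA (b, c))))"

definition tensor_Id ::
    "('k::field \<Rightarrow> 'aa::ab_group_add \<Rightarrow> 'aa) \<Rightarrow> ('a \<times> 'a \<Rightarrow> 'aa)
      \<Rightarrow> ('k \<Rightarrow> 'aaa::ab_group_add \<Rightarrow> 'aaa) \<Rightarrow> ('a \<times> 'a \<times> 'a \<Rightarrow> 'aaa)
      \<Rightarrow> ('aa \<Rightarrow> 'aa) \<Rightarrow> 'aaa \<Rightarrow> 'aaa" where
  "tensor_Id sAA tAA sA3 tA3 \<Phi> =
     linear_extension sA3 UNIV tA3 sA3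
       (\<lambda>(a, b, c). linear_extension sAA UNIV tAA sA3 (\<lambda>(d, e). tA3 (d, e, c)) (\<Phi> (tAA (a, b))))"

definition flip ::
    "('k::field \<Rightarrow> 'aa::ab_group_add \<Rightarrow> 'aa) \<Rightarrow> ('a \<times> 'a \<Rightarrow> 'aa) \<Rightarrow> 'aa \<Rightarrow> 'aa" where
  "flip sAA tAA = linear_extension sAA UNIV tAA sAA (\<lambda>(a, b). tAA (b, a))"

definition lEAS ::
    "('k::field \<Rightarrow> 'aa::ab_group_add \<Rightarrow> 'aa) \<Rightarrow> ('a::ab_group_add \<times> 'a \<Rightarrow> 'aa)
      \<Rightarrow> ('k \<Rightarrow> 'aaa::ab_group_add \<Rightarrow> 'aaa) \<Rightarrow> ('a \<times> 'a \<times> 'a \<Rightarrow> 'aaa)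
      \<Rightarrow> ('aa \<Rightarrow> 'aa) \<Rightarrow> bool" where
  "lEAS sAA tAA sA3 tA3 \<Phi> \<longleftrightarrow>
     Vector_Spaces.linear sAA sAA \<Phi> \<and>
     (let I\<Phi> = Id_tensor sAA tAA sA3 tA3 \<Phi>;
          \<Phi>I = tensor_Id sAA tAA sA3 tA3 \<Phi>;
          I\<tau> = Id_tensor sAA tAA sA3 tA3 (flip sAA tAA)
      in I\<Phi> \<circ> \<Phi>I \<circ> I\<Phi> = \<Phi>I \<circ> I\<tau> \<circ> \<Phi>I)"


section \<open>The products\<close>

definition dot ::
    "('k::field \<Rightarrow> 't::ab_group_add \<Rightarrow> 't) \<Rightarrow> ('a list \<times> 'v list \<Rightarrow> 't) \<Rightarrow> 't \<Rightarrow> 'a \<Rightarrow> 'v \<Rightarrow> 't" where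
  "dot sT w u a x =
     linear_extension sT TAV_words w sT (\<lambda>(as, xs). w (as @ [a], xs @ [x])) u"

text \<open>\<open>u *\<^sub>a v\<close> for a word \<open>v\<close>, whose two lists are given in reverse order, so that the
  recursion removes the last letters of \<open>v\<close>. In the recursive equation \<open>\<Phi> (a \<otimes> b)\<close>
  is written as a sum of tensors \<open>c \<otimes> d\<close>; thus \<open>c\<close> is \<open>a' \<rightarrow> b'\<close> and \<open>d\<close> is
  \<open>a'' \<triangleright> b''\<close>. Only pairs of lists coming from \<open>TAV_words\<close> matter.\<close>

fun ast_word ::
    "('k::field \<Rightarrow> 'aa::ab_group_add \<Rightarrow> 'aa) \<Rightarrow> ('a \<times> 'a \<Rightarrow> 'aa)
      \<Rightarrow> ('k \<Rightarrow> 't::ab_group_add \<Rightarrow> 't) \<Rightarrow> ('a list \<times> 'v list \<Rightarrow> 't)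
      \<Rightarrow> ('aa \<Rightarrow> 'aa) \<Rightarrow> 't \<Rightarrow> 'a \<Rightarrow> 'a list \<Rightarrow> 'v list \<Rightarrow> 't" where
  "ast_word sAA tAA sT w \<Phi> u a [] (z # zs) = dot sT w u a z"
| "ast_word sAA tAA sT w \<Phi> u a (b # bs) (z # zs) =
     linear_extension sAA UNIV tAA sT
       (\<lambda>(c, d). dot sT w (ast_word sAA tAA sT w \<Phi> u d bs zs) c z) (\<Phi> (tAA (a, b)))"
| "ast_word sAA tAA sT w \<Phi> u a bs [] = 0"

definition ast ::
    "('k::field \<Rightarrow> 'aa::ab_group_add \<Rightarrow> 'aa) \<Rightarrow> ('a \<times> 'a \<Rightarrow> 'aa)
      \<Rightarrow> ('k \<Rightarrow> 't::ab_group_add \<Rightarrow> 't) \<Rightarrow> ('a list \<times> 'v list \<Rightarrow> 't)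
      \<Rightarrow> ('aa \<Rightarrow> 'aa) \<Rightarrow> 't \<Rightarrow> 'a \<Rightarrow> 't \<Rightarrow> 't" where
  "ast sAA tAA sT w \<Phi> u a v =
     linear_extension sT TAV_words w sT
       (\<lambda>(bs, zs). ast_word sAA tAA sT w \<Phi> u a (rev bs) (rev zs)) v"

definition star ::
    "('k::field \<Rightarrow> 'aa::ab_group_add \<Rightarrow> 'aa) \<Rightarrow> ('a \<times> 'a \<Rightarrow> 'aa)
      \<Rightarrow> ('k \<Rightarrow> 't::ab_group_add \<Rightarrow> 't) \<Rightarrow> ('a list \<times> 'v list \<Rightarrow> 't)
      \<Rightarrow> ('k \<Rightarrow> 'ta::ab_group_add \<Rightarrow> 'ta) \<Rightarrow> ('t \<times> 'a \<Rightarrow> 'ta)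
      \<Rightarrow> ('aa \<Rightarrow> 'aa) \<Rightarrow> 'ta \<Rightarrow> 'ta \<Rightarrow> 'ta" where
  "star sAA tAA sT w sTA tTA \<Phi> p q =
     linear_extension sTA UNIV tTA sTA
       (\<lambda>(u, a). linear_extension sTA UNIV tTA sTA
         (\<lambda>(v, b). linear_extension sAA UNIV tAA sTA
           (\<lambda>(c, d). tTA (ast sAA tAA sT w \<Phi> u d v, c)) (\<Phi> (tAA (a, b)))) q) p"

definition V_tensor_A ::
    "('a list \<times> 'v list \<Rightarrow> 't) \<Rightarrow> ('k::field \<Rightarrow> 'ta::ab_group_add \<Rightarrow> 'ta) \<Rightarrow> ('t \<times> 'a \<Rightarrow> 'ta)
      \<Rightarrow> 'ta set" where
  "V_tensor_A w sTA tTA = module.span sTA {tTA (w ([], [x]), a) | x a. True}"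


section \<open>Generation and freeness of nonunital algebras\<close>

definition subalgebra ::
    "('k::field \<Rightarrow> 'm::ab_group_add \<Rightarrow> 'm) \<Rightarrow> ('m \<Rightarrow> 'm \<Rightarrow> 'm) \<Rightarrow> 'm set \<Rightarrow> bool" where
  "subalgebra s mult S \<longleftrightarrow> module.subspace s S \<and> (\<forall>x\<in>S. \<forall>y\<in>S. mult x y \<in> S)"

definition generated_subalgebra ::
    "('k::field \<Rightarrow> 'm::ab_group_add \<Rightarrow> 'm) \<Rightarrow> ('m \<Rightarrow> 'm \<Rightarrow> 'm) \<Rightarrow> 'm set \<Rightarrow> 'm set" where
  "generated_subalgebra s mult G = subalgebra s mult hull G"

text \<open>\<open>g\<close> sends the tensor \<open>u\<^sub>1 \<dots> u\<^sub>n\<close> (a nonempty list over \<open>U\<close>) to its image under an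
  isomorphism of algebras from the direct sum of the \<open>n\<close>-fold tensor powers of \<open>U\<close>, \<open>n \<ge> 1\<close>,
  with the concatenation product, onto \<open>S\<close>. Since such an isomorphism embeds \<open>U\<close> into \<open>S\<close>, it
  is no restriction to look for \<open>U\<close> among the subspaces of the ambient space; \<open>g [u] = u\<close> is
  not required.\<close>

definition free_nonunital_algebra ::
    "('k::field \<Rightarrow> 'm::ab_group_add \<Rightarrow> 'm) \<Rightarrow> ('m \<Rightarrow> 'm \<Rightarrow> 'm) \<Rightarrow> 'm set \<Rightarrow> bool" where
  "free_nonunital_algebra s mult S \<longleftrightarrow>
     (\<exists>(U :: 'm set) g.
        module.subspace s U \<and>
        presents s S (lists U - {[]}) g
          (\<Union>us\<in>lists U. \<Union>vs\<in>lists U. slot_relations s U (\<lambda>u. us @ u # vs)) \<and>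
        (\<forall>us\<in>lists U - {[]}. \<forall>vs\<in>lists U - {[]}. g (us @ vs) = mult (g us) (g vs)))"

end

theory Submission
  imports Defs
begin

text \<open>The factor \<open>A\<close> is read as one more letter: \<open>(u \<otimes> a) \<star> (z \<otimes> b)\<close>, with \<open>z\<close> in \<open>V\<close>, appends \<open>z\<close> and
  replaces \<open>a \<otimes> b\<close> by the flip of \<open>\<Phi> (a \<otimes> b)\<close>. Hence \<open>\<Phi>\<close> can be recovered from the products of two elements
  of \<open>V \<otimes> A\<close>, which gives necessity in both parts; in the second one, freeness provides a map out of the
  subalgebra that sends \<open>p \<star> q\<close> to the tensor of the degree one parts of \<open>p\<close> and \<open>q\<close>.
  Conversely, if \<open>\<Phi>\<close> is surjective then words are split off letter by letter. If \<open>\<Phi>\<close> is injective,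
  a linear left inverse of \<open>\<Phi>\<close> gives operators that undo multiplication by a basis element of
  \<open>V \<otimes> A\<close> on the right, and composing them yields functionals dual to the products of basis elements.\<close>

section \<open>Linear maps on presented spaces\<close>

text \<open>Every tensor space is known only through a presentation, and a map prescribed on
  generators is a \<open>THE\<close> whose value is known only once multilinearity is shown. Hence
  linearity in each argument precedes every computation, and identities are checked on generators.
  No grading of T_A(V) is constructed: its splitting into letters and elements u \<cdot> a x takes
  its place, and the degree projections are linear maps prescribed on these two kinds of elements. A
  functional \<psi> on V with value 1 at some x0 reduces V to scalars; the degree two part of (x0
  \<otimes> a) \<star> (x0 \<otimes> b) is then exactly \<Phi> (a \<otimes> b). In the necessity of
  injectivity, the obstacle is that the space of free generators is arbitrary and need not be V
  \<otimes> A. In the converse, freeness is itself a presentation: besides the independence of the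
  products of basis elements, it must be shown that multilinearity alone reduces every formal
  product to products of basis elements.\<close>

abbreviation lin where "lin \<equiv> Vector_Spaces.linear"

lemmas lin_iff = Vector_Spaces.linear_iff

lemma lin_add: "lin s1 s2 f \<Longrightarrow> f (x + y) = f x + f y"
  and lin_scale: "lin s1 s2 f \<Longrightarrow> f (s1 c x) = s2 c (f x)"
  by (auto simp: lin_iff)

lemma lin_zero: "lin s1 s2 f \<Longrightarrow> f 0 = 0"
  by (rule module_hom.zero[OF module_hom_linearI])

lemma lin_diff: "lin s1 s2 f \<Longrightarrow> f (x - y) = f x - f y"
  by (rule module_hom.diff[OF module_hom_linearI])

lemma lin_compose: "lin s1 s2 g \<Longrightarrow> lin s2 s3 f \<Longrightarrow> lin s1 s3 (\<lambda>x. f (g x))"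
  by (auto simp: lin_iff)

lemma lin_plus: "lin s1 s2 f \<Longrightarrow> lin s1 s2 g \<Longrightarrow> lin s1 s2 (\<lambda>x. f x + g x)"
  by (simp add: lin_iff vector_space.vector_space_assms(1))

lemma lin_scaled: "lin s1 s2 f \<Longrightarrow> lin s1 s2 (\<lambda>x. s2 c (f x))"
  by (simp add: lin_iff vector_space.vector_space_assms(1,3) mult.commute)

lemma lin_0: "vector_space s1 \<Longrightarrow> vector_space s2 \<Longrightarrow> lin s1 s2 (\<lambda>x. 0)"
  by (simp add: lin_iff module.scale_zero_right module_iff_vector_space)

lemma lin_id: "vector_space s \<Longrightarrow> lin s s (\<lambda>x. x)"
  by (simp add: lin_iff)

lemma vector_space_mult: "vector_space ((*) :: 'k::field \<Rightarrow> 'k \<Rightarrow> 'k)"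
  by unfold_locales (auto simp: algebra_simps)

lemma lin_smult: "vector_space s \<Longrightarrow> lin (*) s (\<lambda>c. s c x)"
  by (simp add: lin_iff vector_space.vector_space_assms(2,3) vector_space_mult)

interpretation free: vector_space "free_scale :: 'k::field \<Rightarrow> ('x \<Rightarrow>\<^sub>0 'k) \<Rightarrow> ('x \<Rightarrow>\<^sub>0 'k)"
  by (rule vector_space_free_scale)

section \<open>Evaluation of formal linear combinations\<close>

lemma lincomb_superset:
  assumes "vector_space s" "finite F" "Poly_Mapping.keys p \<subseteq> F"
  shows "lincomb s g p = (\<Sum>x\<in>F. s (Poly_Mapping.lookup p x) (g x))"
proof -
  interpret vector_space s by fact
  show ?thesis unfolding lincomb_def
    using assms(2,3) by (intro sum.mono_neutral_left) (auto simp: in_keys_iff)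
qed

lemma lincomb_linear:
  assumes "vector_space s" shows "lin free_scale s (lincomb s g)"
proof -
  interpret vector_space s by fact
  have "lincomb s g (p + q) = lincomb s g p + lincomb s g q" for p q
  proof -
    let ?F = "Poly_Mapping.keys p \<union> Poly_Mapping.keys q"
    have "lincomb s g (p + q) = (\<Sum>x\<in>?F. s (Poly_Mapping.lookup (p + q) x) (g x))"
      using Poly_Mapping.keys_add[of p q] by (intro lincomb_superset[OF assms]) auto
    also have "\<dots> = (\<Sum>x\<in>?F. s (Poly_Mapping.lookup p x) (g x))
        + (\<Sum>x\<in>?F. s (Poly_Mapping.lookup q x) (g x))"
      by (simp add: lookup_add scale_left_distrib sum.distrib)
    also have "\<dots> = lincomb s g p + lincomb s g q"
      by (simp add: lincomb_superset[OF assms, of ?F])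
    finally show ?thesis .
  qed
  moreover have "lincomb s g (free_scale c p) = s c (lincomb s g p)" for c p
  proof -
    have "lincomb s g (free_scale c p)
        = (\<Sum>x\<in>Poly_Mapping.keys p. s (Poly_Mapping.lookup (free_scale c p) x) (g x))"
      by (intro lincomb_superset[OF assms]) (auto simp: in_keys_iff)
    then show ?thesis
      by (simp add: lincomb_def scale_sum_right)
  qed
  ultimately show ?thesis
    using assms by (simp add: lin_iff vector_space_free_scale)
qed

lemma lincomb_single [simp]:
  assumes "vector_space s" shows "lincomb s g (Poly_Mapping.single x c) = s c (g x)"
  using lincomb_superset[OF assms, of "{x}" "Poly_Mapping.single x c" g] by simp

lemma subspace_keys: "free.subspace {p. Poly_Mapping.keys p \<subseteq> X}"
  by (auto simp: free.subspace_def in_keys_iff lookup_add subset_iff) (metis add_0)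

lemma lincomb_image:
  assumes "vector_space s"
  shows "lincomb s g ` {p. Poly_Mapping.keys p \<subseteq> X} = module.span s (g ` X)"
proof -
  interpret vector_space s by fact
  interpret L: Vector_Spaces.linear free_scale s "lincomb s g" by (rule lincomb_linear[OF assms])
  have "lincomb s g p \<in> span (g ` X)" if "Poly_Mapping.keys p \<subseteq> X" for p
    using that unfolding lincomb_def by (intro span_sum span_scale span_base) auto
  moreover have "g ` X \<subseteq> lincomb s g ` {p. Poly_Mapping.keys p \<subseteq> X}"
  proof
    fix y assume "y \<in> g ` X"
    then obtain x where "x \<in> X" "y = lincomb s g (Poly_Mapping.single x 1)"
      using assms by auto
    then show "y \<in> lincomb s g ` {p. Poly_Mapping.keys p \<subseteq> X}" by auto
  qed
  ultimately show ?thesis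
    using span_minimal[OF _ L.subspace_image[OF subspace_keys]] by blast
qed

lemma keys_in_span:
  assumes "Poly_Mapping.keys p \<subseteq> X"
  shows "p \<in> free.span ((\<lambda>x. Poly_Mapping.single x 1) ` X)"
proof -
  have "lincomb free_scale (\<lambda>x. Poly_Mapping.single x 1) p = p"
  proof (rule poly_mapping_eqI)
    fix y
    have "Poly_Mapping.lookup (lincomb free_scale (\<lambda>x. Poly_Mapping.single x 1) p) y
        = (\<Sum>x\<in>Poly_Mapping.keys p. Poly_Mapping.lookup p x * (1 when x = y))"
      by (simp add: lincomb_def lookup_sum lookup_single)
    also have "\<dots> = (\<Sum>x\<in>Poly_Mapping.keys p. if x = y then Poly_Mapping.lookup p y else 0)"
      by (intro sum.cong) auto
    also have "\<dots> = Poly_Mapping.lookup p y"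
      by (auto simp: in_keys_iff)
    finally show "Poly_Mapping.lookup (lincomb free_scale (\<lambda>x. Poly_Mapping.single x 1) p) y
      = Poly_Mapping.lookup p y" .
  qed
  then show ?thesis
    using lincomb_image[OF vector_space_free_scale, of "\<lambda>x. Poly_Mapping.single x 1" X] assms
    by (metis (mono_tags, lifting) image_eqI mem_Collect_eq)
qed

lemma presents_span: "presents s S X g R \<Longrightarrow> S = module.span s (g ` X)"
  by (metis lincomb_image presents_def)

lemma presents_relation: "presents s S X g R \<Longrightarrow> r \<in> R \<Longrightarrow> lincomb s g r = 0"
  unfolding presents_def using free.span_base by blast

lemma presents_eq:
  assumes "presents s S X g R" "lin s sC F" "lin s sC G" "v \<in> S"
    and "\<And>x. x \<in> X \<Longrightarrow> F (g x) = G (g x)"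
  shows "F v = G v"
proof -
  interpret vector_space s using assms(1) by (simp add: presents_def)
  interpret F: Vector_Spaces.linear s sC F by fact
  interpret G: Vector_Spaces.linear s sC G by fact
  have "v \<in> span (g ` X)" using assms presents_span by blast
  then show ?thesis
    by (induction rule: span_induct_alt) (auto simp: F.add G.add F.scale G.scale assms(5))
qed

text \<open>The map is a linear section \<open>h\<close> of the evaluation of formal combinations,
  followed by \<open>lincomb sC f\<close>. On a generator, \<open>h (g x)\<close> differs from the
  formal generator \<open>x\<close> by an element of the span of \<open>R\<close>, which is killed.
  The section inverts only on \<open>S\<close> but is linear on the whole space, so \<open>S\<close>
  may be proper.\<close>

lemma presents_linear_exists:
  assumes P: "presents s S X g R" and C: "vector_space sC"
    and f: "\<And>r. r \<in> R \<Longrightarrow> lincomb sC f r = 0"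
  shows "\<exists>L. lin s sC L \<and> (\<forall>x\<in>X. L (g x) = f x)"
proof -
  interpret s: vector_space s using P by (simp add: presents_def)
  interpret pair: vector_space_pair free_scale s ..
  interpret C: vector_space sC by fact
  interpret Lf: Vector_Spaces.linear free_scale sC "lincomb sC f" by (rule lincomb_linear[OF C])
  note g = lincomb_linear[OF s.vector_space_axioms, of g]
  have S: "lincomb s g ` {p. Poly_Mapping.keys p \<subseteq> X} = S"
    and K: "{p. Poly_Mapping.keys p \<subseteq> X \<and> lincomb s g p = 0} = free.span R"
    using P by (auto simp: presents_def)
  obtain h where h: "range h \<subseteq> {p. Poly_Mapping.keys p \<subseteq> X}" "lin s free_scale h"
      "\<And>v. v \<in> S \<Longrightarrow> lincomb s g (h v) = v"
    using pair.linear_exists_right_inverse_on[OF g subspace_keys[of X]] unfolding S by blast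
  have kill: "lincomb sC f r = 0" if "r \<in> free.span R" for r
    using that by (induction rule: free.span_induct_alt) (auto simp: Lf.add Lf.scale f)
  have "lincomb sC f (h (g x)) = f x" if "x \<in> X" for x
  proof -
    have "g x \<in> S" using that presents_span[OF P] s.span_base by blast
    moreover have "h (g x) - Poly_Mapping.single x 1 \<in> {p. Poly_Mapping.keys p \<subseteq> X}"
      using h(1) that by (intro free.subspace_diff[OF subspace_keys]) auto
    ultimately have "h (g x) - Poly_Mapping.single x 1 \<in> free.span R"
      using h(3) unfolding K[symmetric] by (simp add: lin_diff[OF g] s.vector_space_axioms)
    from kill[OF this] show ?thesis
      by (simp add: Lf.diff C)
  qed
  then show ?thesis
    using lin_compose[OF h(2) lincomb_linear[OF C, of f]] by blast
qed

text \<open>With \<open>UNIV\<close> presented, agreement on generators determines a linear map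
  everywhere, so the \<open>THE\<close> denotes the map that exists.\<close>

lemma linear_extension:
  assumes P: "presents s UNIV X g R" and C: "vector_space sC"
    and f: "\<And>r. r \<in> R \<Longrightarrow> lincomb sC f r = 0"
  shows linear_linear_extension: "lin s sC (linear_extension s X g sC f)"
    and linear_extension_generator: "x \<in> X \<Longrightarrow> linear_extension s X g sC f (g x) = f x"
proof -
  have "\<exists>!L. lin s sC L \<and> (\<forall>x\<in>X. L (g x) = f x)"
  proof (rule ex_ex1I)
    show "\<exists>L. lin s sC L \<and> (\<forall>x\<in>X. L (g x) = f x)"
      by (rule presents_linear_exists[OF P C f])
    show "L = M" if "lin s sC L \<and> (\<forall>x\<in>X. L (g x) = f x)" "lin s sC M \<and> (\<forall>x\<in>X. M (g x) = f x)" for L M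
      using presents_eq[OF P, of sC L M] that by auto
  qed
  from theI'[OF this] show "lin s sC (linear_extension s X g sC f)"
    "x \<in> X \<Longrightarrow> linear_extension s X g sC f (g x) = f x"
    unfolding linear_extension_def by auto
qed

text \<open>A set \<open>U\<close> is allowed because freeness concerns tensor powers of a subspace
  of the ambient space, where linearity on the whole type cannot be asked for.\<close>

lemma slot_relations_iff:
  assumes "vector_space sC"
  shows "(\<forall>r\<in>slot_relations s U h. lincomb sC f r = 0) \<longleftrightarrow>
    (\<forall>u\<in>U. \<forall>v\<in>U. f (h (u + v)) = f (h u) + f (h v)) \<and> (\<forall>c. \<forall>u\<in>U. f (h (s c u)) = sC c (f (h u)))"
proof -
  interpret C: vector_space sC by fact
  interpret Lf: Vector_Spaces.linear free_scale sC "lincomb sC f" by (rule lincomb_linear[OF assms])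
  have *: "lincomb sC f (Poly_Mapping.single x 1 - Poly_Mapping.single y 1 - Poly_Mapping.single z 1) = 0
      \<longleftrightarrow> f x = f y + f z" for x y z
    by (simp add: Lf.diff assms diff_eq_eq) (simp add: add.commute)
  have **: "lincomb sC f (Poly_Mapping.single x 1 - Poly_Mapping.single y c) = 0
      \<longleftrightarrow> f x = sC c (f y)" for x y c
    by (simp add: Lf.diff assms)
  show ?thesis
    unfolding slot_relations_def ball_Un * ** by (auto simp flip: * **)
qed


lemma slot_relations_lin:
  assumes "vector_space s" "vector_space sC"
  shows "(\<forall>r\<in>slot_relations s UNIV h. lincomb sC f r = 0) \<longleftrightarrow> lin s sC (\<lambda>u. f (h u))"
  using assms by (simp add: slot_relations_iff lin_iff)

lemma lincomb_slot:
  "r \<in> slot_relations s UNIV h \<Longrightarrow> lin s sC (\<lambda>u. f (h u)) \<Longrightarrow> lincomb sC f r = 0"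
  using slot_relations_lin[of s sC h f] by (simp add: lin_iff)

lemma presents_slot_lin:
  assumes P: "presents s S X g R" and "vector_space s'" "slot_relations s' UNIV h \<subseteq> R"
  shows "lin s' s (\<lambda>u. g (h u))"
proof -
  have "vector_space s" using P by (simp add: presents_def)
  moreover have "\<forall>r\<in>slot_relations s' UNIV h. lincomb s g r = 0"
    using presents_relation[OF P] assms(3) by blast
  ultimately show ?thesis
    using slot_relations_lin[OF assms(2), of s h g] by blast
qed

section \<open>Universal properties of tensor products and of the space of words\<close>

lemma tensor_product_lin:
  assumes "tensor_product sA sB sAB t" "vector_space sA" "vector_space sB"
  shows tensor_product_lin_left: "lin sA sAB (\<lambda>a. t (a, b))"
    and tensor_product_lin_right: "lin sB sAB (\<lambda>b. t (a, b))"
proof -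
  note P = assms(1)[unfolded tensor_product_def]
  show "lin sA sAB (\<lambda>a. t (a, b))"
    by (rule presents_slot_lin[OF P assms(2), of "\<lambda>a. (a, b)"]) blast
  show "lin sB sAB (\<lambda>b. t (a, b))"
    by (rule presents_slot_lin[OF P assms(3), of "\<lambda>b. (a, b)"]) blast
qed

lemma tensor_product_eq:
  assumes "tensor_product sA sB sAB t" "lin sAB sC F" "lin sAB sC G"
    and "\<And>a b. F (t (a, b)) = G (t (a, b))"
  shows "F X = G X"
  using presents_eq[OF assms(1)[unfolded tensor_product_def] assms(2,3), of X] assms(4) by auto

lemma tensor_product_extension:
  assumes T: "tensor_product sA sB sAB t"
    and l: "\<And>b. lin sA sC (\<lambda>a. f a b)" and r: "\<And>a. lin sB sC (\<lambda>b. f a b)"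
  shows lin_tensor_product_extension:
      "lin sAB sC (linear_extension sAB UNIV t sC (\<lambda>(a, b). f a b))"
    and tensor_product_extension_tensor:
      "linear_extension sAB UNIV t sC (\<lambda>(a, b). f a b) (t (a, b)) = f a b"
proof -
  note P = T[unfolded tensor_product_def]
  have vs: "vector_space sA" "vector_space sB" "vector_space sC"
    using l[of undefined] r[of undefined] by (auto simp: lin_iff)
  have "lincomb sC (\<lambda>(a, b). f a b) r = 0"
    if "r \<in> (\<Union>b. slot_relations sA UNIV (\<lambda>a. (a, b))) \<union> (\<Union>a. slot_relations sB UNIV (\<lambda>b. (a, b)))" for r
    using that by (elim UnE UN_E) (erule lincomb_slot, simp add: l r)+
  note E = linear_extension[OF P vs(3) this]
  show "lin sAB sC (linear_extension sAB UNIV t sC (\<lambda>(a, b). f a b))" by (rule E(1))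
  show "linear_extension sAB UNIV t sC (\<lambda>(a, b). f a b) (t (a, b)) = f a b" using E(2) by simp
qed

text \<open>Additivity and homogeneity in the parameter are equations between linear functions of
  \<open>X\<close>, so pure tensors decide. This makes nested extensions, such as the recursive
  product, linear in their outer arguments.\<close>

lemma tensor_product_extension_param:
  assumes T: "tensor_product sA sB sAB t"
    and l: "\<And>d b. lin sA sC (\<lambda>a. f d a b)" and r: "\<And>d a. lin sB sC (\<lambda>b. f d a b)"
    and p: "\<And>a b. lin sD sC (\<lambda>d. f d a b)"
  shows "lin sD sC (\<lambda>d. linear_extension sAB UNIV t sC (\<lambda>(a, b). f d a b) X)"
proof -
  let ?L = "\<lambda>d. linear_extension sAB UNIV t sC (\<lambda>(a, b). f d a b)"
  note E = tensor_product_extension[OF T l r]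
  have "?L (d + e) X = ?L d X + ?L e X" for d e
    by (rule tensor_product_eq[OF T E(1) lin_plus[OF E(1) E(1)]]) (simp only: E(2), rule lin_add[OF p])
  moreover have "?L (sD c d) X = sC c (?L d X)" for c d
    by (rule tensor_product_eq[OF T E(1) lin_scaled[OF E(1)]]) (simp only: E(2), rule lin_scale[OF p])
  ultimately show ?thesis
    using p[of undefined undefined] by (simp add: lin_iff)
qed

lemma tensor_cube_lin:
  assumes "tensor_cube sA sC t" "vector_space sA"
  shows tensor_cube_lin1: "lin sA sC (\<lambda>a. t (a, b, c))"
    and tensor_cube_lin2: "lin sA sC (\<lambda>b. t (a, b, c))"
    and tensor_cube_lin3: "lin sA sC (\<lambda>c. t (a, b, c))"
proof -
  note P = assms(1)[unfolded tensor_cube_def]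
  show "lin sA sC (\<lambda>a. t (a, b, c))"
    by (rule presents_slot_lin[OF P assms(2), of "\<lambda>a. (a, b, c)"]) blast
  show "lin sA sC (\<lambda>b. t (a, b, c))"
    by (rule presents_slot_lin[OF P assms(2), of "\<lambda>b. (a, b, c)"]) blast
  show "lin sA sC (\<lambda>c. t (a, b, c))"
    by (rule presents_slot_lin[OF P assms(2), of "\<lambda>c. (a, b, c)"])
      (rule le_supI2, rule SUP_upper2[OF UNIV_I], rule SUP_upper[OF UNIV_I])
qed

lemma tensor_cube_extension:
  assumes T: "tensor_cube sA sA3 t"
    and l: "\<And>b c. lin sA sC (\<lambda>a. f a b c)" "\<And>a c. lin sA sC (\<lambda>b. f a b c)"
      "\<And>a b. lin sA sC (\<lambda>c. f a b c)"
  shows lin_tensor_cube_extension: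
      "lin sA3 sC (linear_extension sA3 UNIV t sC (\<lambda>(a, b, c). f a b c))"
    and tensor_cube_extension_tensor:
      "linear_extension sA3 UNIV t sC (\<lambda>(a, b, c). f a b c) (t (a, b, c)) = f a b c"
proof -
  note P = T[unfolded tensor_cube_def]
  have vs: "vector_space sA" "vector_space sC"
    using l(1)[of undefined undefined] by (auto simp: lin_iff)
  have "lincomb sC (\<lambda>(a, b, c). f a b c) r = 0"
    if "r \<in> (\<Union>b c. slot_relations sA UNIV (\<lambda>a. (a, b, c))) \<union>
        (\<Union>a c. slot_relations sA UNIV (\<lambda>b. (a, b, c))) \<union>
        (\<Union>a b. slot_relations sA UNIV (\<lambda>c. (a, b, c)))" for r
    using that by (elim UnE UN_E) (erule lincomb_slot, simp add: l)+
  note E = linear_extension[OF P vs(2) this]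
  show "lin sA3 sC (linear_extension sA3 UNIV t sC (\<lambda>(a, b, c). f a b c))" by (rule E(1))
  show "linear_extension sA3 UNIV t sC (\<lambda>(a, b, c). f a b c) (t (a, b, c)) = f a b c"
    using E(2) by simp
qed

lemma TAV_lin:
  assumes "TAV sA sV sT w" "vector_space sA" "vector_space sV"
  shows TAV_lin_A: "length xs = length as + length bs + 2 \<Longrightarrow> lin sA sT (\<lambda>a. w (as @ a # bs, xs))"
    and TAV_lin_V: "length as = length xs + length ys \<Longrightarrow> lin sV sT (\<lambda>x. w (as, xs @ x # ys))"
proof -
  note P = assms(1)[unfolded TAV_def]
  show "lin sA sT (\<lambda>a. w (as @ a # bs, xs))" if "length xs = length as + length bs + 2"
    using that by (intro presents_slot_lin[OF P assms(2), of "\<lambda>a. (as @ a # bs, xs)"]) blast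
  show "lin sV sT (\<lambda>x. w (as, xs @ x # ys))" if "length as = length xs + length ys"
    using that by (intro presents_slot_lin[OF P assms(3), of "\<lambda>x. (as, xs @ x # ys)"]) blast
qed

lemma TAV_extension:
  assumes T: "TAV sA sV sT w" and vs: "vector_space sA" "vector_space sV" "vector_space sC"
    and A: "\<And>as bs xs. length xs = length as + length bs + 2 \<Longrightarrow> lin sA sC (\<lambda>a. f (as @ a # bs, xs))"
    and V: "\<And>as xs ys. length as = length xs + length ys \<Longrightarrow> lin sV sC (\<lambda>x. f (as, xs @ x # ys))"
  shows lin_TAV_extension: "lin sT sC (linear_extension sT TAV_words w sC f)"
    and TAV_extension_word:
      "length xs = Suc (length as) \<Longrightarrow> linear_extension sT TAV_words w sC f (w (as, xs)) = f (as, xs)"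
proof -
  note P = T[unfolded TAV_def]
  have "lincomb sC f r = 0"
    if "r \<in> \<Union>{slot_relations sA UNIV (\<lambda>a. (as @ a # bs, xs)) | as bs xs.
            length xs = length as + length bs + 2} \<union>
        \<Union>{slot_relations sV UNIV (\<lambda>x. (as, xs @ x # ys)) | as xs ys.
            length as = length xs + length ys}" for r
    using that
  proof (elim UnE)
    assume "r \<in> \<Union>{slot_relations sA UNIV (\<lambda>a. (as @ a # bs, xs)) | as bs xs.
            length xs = length as + length bs + 2}"
    then obtain as bs xs where "r \<in> slot_relations sA UNIV (\<lambda>a. (as @ a # bs, xs))"
        "length xs = length as + length bs + 2"
      by blast
    then show ?thesis
      by (rule lincomb_slot[where h = "\<lambda>a. (as @ a # bs, xs)", OF _ A])
  next
    assume "r \<in> \<Union>{slot_relations sV UNIV (\<lambda>x. (as, xs @ x # ys)) | as xs ys.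
            length as = length xs + length ys}"
    then obtain as xs ys where "r \<in> slot_relations sV UNIV (\<lambda>x. (as, xs @ x # ys))"
        "length as = length xs + length ys"
      by blast
    then show ?thesis
      by (rule lincomb_slot[where h = "\<lambda>x. (as, xs @ x # ys)", OF _ V])
  qed
  note E = linear_extension[OF P vs(3) this]
  show "lin sT sC (linear_extension sT TAV_words w sC f)" by (rule E(1))
  show "linear_extension sT TAV_words w sC f (w (as, xs)) = f (as, xs)"
    if "length xs = Suc (length as)"
    using E(2)[of "(as, xs)"] that by (simp add: TAV_words_def)
qed

lemma TAV_eq_words:
  assumes "TAV sA sV sT w" "lin sT sC F" "lin sT sC G"
    and "\<And>as xs. length xs = Suc (length as) \<Longrightarrow> F (w (as, xs)) = G (w (as, xs))"
  shows "F v = G v"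
  by (rule presents_eq[OF assms(1)[unfolded TAV_def] assms(2,3)]) (auto simp: TAV_words_def assms(4))

lemma TAV_eq:
  assumes "TAV sA sV sT w" "lin sT sC F" "lin sT sC G"
    and base: "\<And>x. F (w ([], [x])) = G (w ([], [x]))"
    and snoc: "\<And>as xs a x. length xs = Suc (length as) \<Longrightarrow>
      F (w (as @ [a], xs @ [x])) = G (w (as @ [a], xs @ [x]))"
  shows "F v = G v"
proof (rule TAV_eq_words[OF assms(1,2,3)])
  fix as :: "'b list" and xs :: "'c list"
  assume l: "length xs = Suc (length as)"
  show "F (w (as, xs)) = G (w (as, xs))"
  proof (cases as rule: rev_cases)
    case Nil
    with l base show ?thesis by (auto simp: length_Suc_conv)
  next
    case (snoc as' a)
    with l obtain xs' x where "xs = xs' @ [x]" by (metis length_0_conv nat.distinct(1) rev_exhaust)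
    with l snoc assms(5) show ?thesis by auto
  qed
qed

text \<open>Universal property of the decomposition of T_A(V) as V \<oplus> T_A(V) \<otimes> A
  \<otimes> V, which separates the last letters. The function \<open>k2\<close> sees the shorter
  word itself and not the value of \<open>L\<close> on it, so a case distinction suffices to define
  \<open>L\<close>.\<close>

lemma TAV_recursion:
  assumes T: "TAV sA sV sT w" and vs: "vector_space sA" "vector_space sV"
    and k1: "lin sV sC k1"
    and k2: "\<And>a x. lin sT sC (\<lambda>u. k2 u a x)" "\<And>u x. lin sA sC (\<lambda>a. k2 u a x)"
      "\<And>u a. lin sV sC (\<lambda>x. k2 u a x)"
  shows "\<exists>L. lin sT sC L \<and> (\<forall>x. L (w ([], [x])) = k1 x) \<and>
    (\<forall>as xs a x. length xs = Suc (length as) \<longrightarrow> L (w (as @ [a], xs @ [x])) = k2 (w (as, xs)) a x)"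
proof -
  define f where "f = (\<lambda>(as, xs). if as = [] then k1 (last xs)
    else k2 (w (butlast as, butlast xs)) (last as) (last xs))"
  have vsC: "vector_space sC" using k1 by (simp add: lin_iff)
  have A: "lin sA sC (\<lambda>a. f (as @ a # bs, xs))" if "length xs = length as + length bs + 2" for as bs xs
  proof (cases "bs = []")
    case True
    then show ?thesis using k2(2) by (simp add: f_def)
  next
    case False
    then have "lin sA sT (\<lambda>a. w (as @ a # butlast bs, butlast xs))"
      using that by (intro TAV_lin_A[OF T vs]) (cases bs, auto)
    from lin_compose[OF this k2(1)] False show ?thesis
      by (simp add: f_def butlast_append)
  qed
  have V: "lin sV sC (\<lambda>x. f (as, xs @ x # ys))" if "length as = length xs + length ys" for as xs ys
  proof (cases "ys = []")
    case True
    then show ?thesis using k1 k2(3) by (cases "as = []") (simp_all add: f_def)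
  next
    case False
    then have "lin sV sT (\<lambda>x. w (butlast as, xs @ x # butlast ys))"
      using that by (intro TAV_lin_V[OF T vs]) (cases ys, auto)
    moreover have "as \<noteq> []" using False that by auto
    ultimately show ?thesis
      using lin_compose[OF _ k2(1)] False by (simp add: f_def butlast_append)
  qed
  note E = TAV_extension[OF T vs vsC A V]
  show ?thesis
  proof (intro exI conjI allI impI)
    show "lin sT sC (linear_extension sT TAV_words w sC f)" by (rule E(1))
  qed (simp_all add: E(2), simp_all add: f_def)
qed

section \<open>Bases, functionals and spanning sets\<close>

lemma dual_basis_exists:
  assumes "vector_space s"
  obtains B c where "module.span s B = UNIV" "\<And>x. lin s (*) (c x)"
    "\<And>x y. x \<in> B \<Longrightarrow> y \<in> B \<Longrightarrow> c x y = (if y = x then 1 else 0)"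
proof -
  interpret s: vector_space s by fact
  interpret vector_space_pair s "(*)" by (intro vector_space_pair.intro assms vector_space_mult)
  obtain B where B: "s.independent B" "UNIV \<subseteq> s.span B"
    using s.maximal_independent_subset[of UNIV] by blast
  have "\<forall>x. \<exists>c. lin s (*) c \<and> (\<forall>y\<in>B. c y = (if y = x then 1 else 0))"
    by (intro allI linear_independent_extend[OF B(1)])
  then obtain c where "\<forall>x. lin s (*) (c x) \<and> (\<forall>y\<in>B. c x y = (if y = x then 1 else 0))"
    by metis
  with B that show ?thesis by blast
qed

lemma functional_exists:
  assumes "vector_space s" "x \<noteq> 0"
  obtains f where "lin s (*) f" "f x = 1"
proof -
  interpret s: vector_space s by fact
  interpret vector_space_pair s "(*)" by (intro vector_space_pair.intro assms vector_space_mult)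
  show ?thesis
    using linear_independent_extend[of "{x}" "\<lambda>_. 1"] assms(2) that by auto
qed

lemma tensor_product_span:
  "tensor_product sA sB sAB t \<Longrightarrow> X \<in> module.span sAB (range t)"
  unfolding tensor_product_def using presents_span by blast

lemma bilinear_span:
  assumes l: "\<And>y. lin s1 s3 (\<lambda>x. h x y)" and r: "\<And>x. lin s2 s3 (\<lambda>y. h x y)"
    and "module.span s1 B = UNIV" "module.span s2 C = UNIV"
  shows "h x y \<in> module.span s3 {h x y | x y. x \<in> B \<and> y \<in> C}"
proof -
  interpret s1: vector_space s1 using l[of undefined] by (simp add: lin_iff)
  interpret s2: vector_space s2 using r[of undefined] by (simp add: lin_iff)
  interpret s3: vector_space s3 using r[of undefined] by (simp add: lin_iff)
  let ?S = "s3.span {h x y | x y. x \<in> B \<and> y \<in> C}"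
  have B: "h b y \<in> ?S" if "b \<in> B" for b
  proof -
    have "y \<in> s2.span C" using assms by simp
    then show ?thesis
      by (induction rule: s2.span_induct_alt)
        (use that in \<open>auto simp: lin_add[OF r] lin_scale[OF r] lin_zero[OF r]
          intro!: s3.span_add s3.span_scale s3.span_zero intro: s3.span_base\<close>)
  qed
  have "x \<in> s1.span B" using assms by simp
  then show ?thesis
    by (induction rule: s1.span_induct_alt)
      (auto simp: B lin_add[OF l] lin_scale[OF l] lin_zero[OF l]
          intro!: s3.span_add s3.span_scale s3.span_zero)
qed

section \<open>Bilinearity of the products\<close>

locale leas_setting =
  fixes sA :: "'k::field \<Rightarrow> 'a::ab_group_add \<Rightarrow> 'a"
    and sV :: "'k \<Rightarrow> 'v::ab_group_add \<Rightarrow> 'v"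
    and sAA :: "'k \<Rightarrow> 'aa::ab_group_add \<Rightarrow> 'aa" and tAA :: "'a \<times> 'a \<Rightarrow> 'aa"
    and sA3 :: "'k \<Rightarrow> 'aaa::ab_group_add \<Rightarrow> 'aaa" and tA3 :: "'a \<times> 'a \<times> 'a \<Rightarrow> 'aaa"
    and sT :: "'k \<Rightarrow> 't::ab_group_add \<Rightarrow> 't" and w :: "'a list \<times> 'v list \<Rightarrow> 't"
    and sTA :: "'k \<Rightarrow> 'ta::ab_group_add \<Rightarrow> 'ta" and tTA :: "'t \<times> 'a \<Rightarrow> 'ta"
    and \<Phi> :: "'aa \<Rightarrow> 'aa"
  assumes vsA: "vector_space sA" and vsV: "vector_space sV"
    and AA: "tensor_product sA sA sAA tAA"
    and A3: "tensor_cube sA sA3 tA3"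
    and T: "TAV sA sV sT w"
    and TA: "tensor_product sT sA sTA tTA"
    and leas: "lEAS sAA tAA sA3 tA3 \<Phi>"
begin

lemma vsT: "vector_space sT" and vsAA: "vector_space sAA" and vsTA: "vector_space sTA"
  using T AA TA by (simp_all add: TAV_def tensor_product_def presents_def)

lemma linear_Phi: "lin sAA sAA \<Phi>"
  using leas by (simp add: lEAS_def)

lemmas tAA_lin1 = tensor_product_lin_left[OF AA vsA vsA]
  and tAA_lin2 = tensor_product_lin_right[OF AA vsA vsA]
  and tTA_lin1 = tensor_product_lin_left[OF TA vsT vsA]
  and tTA_lin2 = tensor_product_lin_right[OF TA vsT vsA]
  and tA3_lin1 = tensor_cube_lin1[OF A3 vsA]
  and tA3_lin2 = tensor_cube_lin2[OF A3 vsA]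
  and tA3_lin3 = tensor_cube_lin3[OF A3 vsA]

lemma Phi_lin1: "lin sA sAA (\<lambda>a. \<Phi> (tAA (a, b)))"
  and Phi_lin2: "lin sA sAA (\<lambda>b. \<Phi> (tAA (a, b)))"
  by (rule lin_compose[OF tAA_lin1 linear_Phi] lin_compose[OF tAA_lin2 linear_Phi])+

abbreviation dt where "dt \<equiv> dot sT w"
abbreviation asw where "asw \<equiv> ast_word sAA tAA sT w \<Phi>"
abbreviation asp where "asp \<equiv> ast sAA tAA sT w \<Phi>"
abbreviation str (infixl "\<star>" 70) where "str \<equiv> star sAA tAA sT w sTA tTA \<Phi>"

lemma dot_lin_u: "lin sT sT (\<lambda>u. dt u a x)"
  and dot_word: "length xs = Suc (length as) \<Longrightarrow> dt (w (as, xs)) a x = w (as @ [a], xs @ [x])"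
proof -
  let ?f = "\<lambda>(as, xs). w (as @ [a], xs @ [x])"
  have A: "lin sA sT (\<lambda>a. ?f (as @ a # bs, xs))" if "length xs = length as + length bs + 2" for as bs xs
    using TAV_lin_A[OF T vsA vsV, of "xs @ [x]" as "bs @ [a]"] that by simp
  have V: "lin sV sT (\<lambda>x. ?f (as, xs @ x # ys))" if "length as = length xs + length ys" for as xs ys
    using TAV_lin_V[OF T vsA vsV, of "as @ [a]" xs "ys @ [x]"] that by simp
  note E = TAV_extension[OF T vsA vsV vsT, of ?f, OF A V]
  show "lin sT sT (\<lambda>u. dt u a x)" unfolding dot_def by (rule E(1))
  show "length xs = Suc (length as) \<Longrightarrow> dt (w (as, xs)) a x = w (as @ [a], xs @ [x])"
    unfolding dot_def using E(2) by simp
qed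

lemma dot_lin_a: "lin sA sT (\<lambda>a. dt u a x)"
proof -
  have W: "lin sA sT (\<lambda>a. w (as @ [a], xs @ [x]))" if "length xs = Suc (length as)" for as xs
    using TAV_lin_A[OF T vsA vsV, of "xs @ [x]" as "[]"] that by simp
  have "dt u (a + b) x = dt u a x + dt u b x" for a b
    by (rule TAV_eq_words[OF T dot_lin_u lin_plus[OF dot_lin_u dot_lin_u]])
      (simp add: dot_word lin_add[OF W])
  moreover have "dt u (sA c a) x = sT c (dt u a x)" for a c
    by (rule TAV_eq_words[OF T dot_lin_u lin_scaled[OF dot_lin_u]])
      (simp add: dot_word lin_scale[OF W])
  ultimately show ?thesis by (simp add: lin_iff vsA vsT)
qed

lemma dot_lin_x: "lin sV sT (\<lambda>x. dt u a x)"
proof -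
  have W: "lin sV sT (\<lambda>x. w (as @ [a], xs @ [x]))" if "length xs = Suc (length as)" for as xs
    using TAV_lin_V[OF T vsA vsV, of "as @ [a]" xs "[]"] that by simp
  have "dt u a (x + y) = dt u a x + dt u a y" for x y
    by (rule TAV_eq_words[OF T dot_lin_u lin_plus[OF dot_lin_u dot_lin_u]])
      (simp add: dot_word lin_add[OF W])
  moreover have "dt u a (sV c x) = sT c (dt u a x)" for x c
    by (rule TAV_eq_words[OF T dot_lin_u lin_scaled[OF dot_lin_u]])
      (simp add: dot_word lin_scale[OF W])
  ultimately show ?thesis by (simp add: lin_iff vsV vsT)
qed

text \<open>Letters and elements \<open>dt u a x\<close> span T_A(V). With \<open>u\<close>
  arbitrary, later arguments can avoid lists of letters.\<close>

lemma word_eq: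
  assumes "lin sT sC F" "lin sT sC G"
    and "\<And>x. F (w ([], [x])) = G (w ([], [x]))"
    and "\<And>u a x. F (dt u a x) = G (dt u a x)"
  shows "F v = G v"
proof (rule TAV_eq[OF T assms(1,2,3)])
  show "F (w (as @ [a], xs @ [x])) = G (w (as @ [a], xs @ [x]))"
    if "length xs = Suc (length as)" for as xs a x
    using assms(4)[of "w (as, xs)" a x] that by (simp add: dot_word)
qed

lemma word_recursion:
  assumes k1: "lin sV sC k1"
    and k2: "\<And>a x. lin sT sC (\<lambda>u. k2 u a x)" "\<And>u x. lin sA sC (\<lambda>a. k2 u a x)"
      "\<And>u a. lin sV sC (\<lambda>x. k2 u a x)"
  obtains L where "lin sT sC L" "\<And>x. L (w ([], [x])) = k1 x" "\<And>u a x. L (dt u a x) = k2 u a x"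
proof -
  obtain L where L: "lin sT sC L" "\<And>x. L (w ([], [x])) = k1 x"
      "\<And>as xs a x. length xs = Suc (length as) \<Longrightarrow> L (w (as @ [a], xs @ [x])) = k2 (w (as, xs)) a x"
    using TAV_recursion[OF T vsA vsV k1 k2] by blast
  have "L (dt u a x) = k2 u a x" for u a x
    by (rule TAV_eq_words[OF T lin_compose[OF dot_lin_u L(1)] k2(1)]) (simp add: dot_word L(3))
  with L that show ?thesis by blast
qed

text \<open>In the recursive call this argument is filled by \<open>d\<close>. Only its linearity
  for shorter words makes the function of \<open>(c, d)\<close> bilinear, so that its linear
  extension has the intended values; the other linearity lemmas build on this one.\<close>

lemma asw_lin_a: "lin sA sT (\<lambda>a. asw u a bs zs)"
proof (induction bs arbitrary: zs)
  case Nil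
  show ?case by (cases zs) (simp_all add: dot_lin_a lin_0 vsA vsT)
next
  case (Cons b bs)
  have "lin sA sT (\<lambda>d. dt (asw u d bs zs) c z)" for c z zs
    by (rule lin_compose[OF Cons.IH dot_lin_u])
  then have "lin sAA sT (linear_extension sAA UNIV tAA sT (\<lambda>(c, d). dt (asw u d bs zs) c z))" for z zs
    by (rule lin_tensor_product_extension[OF AA dot_lin_a])
  from lin_compose[OF Phi_lin1 this]
  have "lin sA sT (\<lambda>a. asw u a (b # bs) (z # zs))" for z zs
    by simp
  then show ?case by (cases zs) (simp_all add: lin_0 vsA vsT)
qed

lemma asw_step_lin: "lin sA sT (\<lambda>c. dt (asw u d bs zs) c z)" "lin sA sT (\<lambda>d. dt (asw u d bs zs) c z)"
  by (rule dot_lin_a lin_compose[OF asw_lin_a dot_lin_u])+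

lemma asw_lin_u: "lin sT sT (\<lambda>u. asw u a bs zs)"
proof (induction bs arbitrary: a zs)
  case Nil
  show ?case by (cases zs) (simp_all add: dot_lin_u lin_0 vsT)
next
  case (Cons b bs)
  have "lin sT sT (\<lambda>u. asw u a (b # bs) (z # zs))" for z zs
    by (simp, rule tensor_product_extension_param[OF AA asw_step_lin])
      (rule lin_compose[OF Cons.IH dot_lin_u])
  then show ?case by (cases zs) (simp_all add: lin_0 vsT)
qed

lemma asw_lin_slot_A: "lin sA sT (\<lambda>b. asw u a (bs @ b # bs') zs)"
proof (induction bs arbitrary: a zs)
  case Nil
  have "lin sA sT (\<lambda>b. asw u a (b # bs') (z # zs))" for z zs
    by (simp, rule lin_compose[OF Phi_lin2 lin_tensor_product_extension[OF AA asw_step_lin]])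
  then show ?case by (cases zs) (simp_all add: lin_0 vsA vsT)
next
  case (Cons b bs)
  have "lin sA sT (\<lambda>c. asw u a (b # bs @ c # bs') (z # zs))" for z zs
    by (simp, rule tensor_product_extension_param[OF AA asw_step_lin])
      (rule lin_compose[OF Cons.IH dot_lin_u])
  then show ?case by (cases zs) (simp_all add: lin_0 vsA vsT)
qed

text \<open>The lengths matter: once the letters from A are used up, \<open>ast_word\<close> reads
  one vector and ignores the rest, so it would be constant in a later slot.\<close>

lemma asw_lin_slot_V:
  "length bs = length zs + length zs' \<Longrightarrow> lin sV sT (\<lambda>z. asw u a bs (zs @ z # zs'))"
proof (induction zs arbitrary: a bs)
  case Nil
  show ?case
  proof (cases bs)
    case Nil
    then show ?thesis by (simp add: dot_lin_x)
  next
    case (Cons b bs)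
    then show ?thesis
      by (simp, intro tensor_product_extension_param[OF AA asw_step_lin] dot_lin_x)
  qed
next
  case (Cons z zs)
  then obtain b bs' where [simp]: "bs = b # bs'" by (cases bs) auto
  have "lin sV sT (\<lambda>z. asw u a bs' (zs @ z # zs'))" for a
    using Cons by simp
  from lin_compose[OF this dot_lin_u] show ?case
    by (simp, intro tensor_product_extension_param[OF AA asw_step_lin])
qed

section \<open>The products on the whole spaces\<close>

lemma ast_lin_v: "lin sT sT (\<lambda>v. asp u a v)"
  and ast_word: "length zs = Suc (length bs) \<Longrightarrow> asp u a (w (bs, zs)) = asw u a (rev bs) (rev zs)"
proof -
  let ?f = "\<lambda>(bs, zs). asw u a (rev bs) (rev zs)"
  have A: "lin sA sT (\<lambda>b. ?f (as @ b # bs, xs))" if "length xs = length as + length bs + 2" for as bs xs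
    by (simp add: asw_lin_slot_A)
  have V: "lin sV sT (\<lambda>x. ?f (as, xs @ x # ys))" if "length as = length xs + length ys" for as xs ys
    using that by (simp add: asw_lin_slot_V)
  note E = TAV_extension[OF T vsA vsV vsT, of ?f, OF A V]
  show "lin sT sT (\<lambda>v. asp u a v)" unfolding ast_def by (rule E(1))
  show "length zs = Suc (length bs) \<Longrightarrow> asp u a (w (bs, zs)) = asw u a (rev bs) (rev zs)"
    unfolding ast_def using E(2) by simp
qed

lemma ast_lin_u: "lin sT sT (\<lambda>u. asp u a v)"
proof -
  have "asp (u + u') a v = asp u a v + asp u' a v" for u u'
    by (rule TAV_eq_words[OF T ast_lin_v lin_plus[OF ast_lin_v ast_lin_v]])
      (simp add: ast_word lin_add[OF asw_lin_u])
  moreover have "asp (sT c u) a v = sT c (asp u a v)" for u c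
    by (rule TAV_eq_words[OF T ast_lin_v lin_scaled[OF ast_lin_v]])
      (simp add: ast_word lin_scale[OF asw_lin_u])
  ultimately show ?thesis by (simp add: lin_iff vsT)
qed

lemma ast_lin_a: "lin sA sT (\<lambda>a. asp u a v)"
proof -
  have "asp u (a + a') v = asp u a v + asp u a' v" for a a'
    by (rule TAV_eq_words[OF T ast_lin_v lin_plus[OF ast_lin_v ast_lin_v]])
      (simp add: ast_word lin_add[OF asw_lin_a])
  moreover have "asp u (sA c a) v = sT c (asp u a v)" for a c
    by (rule TAV_eq_words[OF T ast_lin_v lin_scaled[OF ast_lin_v]])
      (simp add: ast_word lin_scale[OF asw_lin_a])
  ultimately show ?thesis by (simp add: lin_iff vsT vsA)
qed

lemma ast_letter: "asp u a (w ([], [z])) = dt u a z"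
  by (simp add: ast_word)

lemma ast_step_lin: "lin sA sT (\<lambda>c. dt (asp u d v) c z)" "lin sA sT (\<lambda>d. dt (asp u d v) c z)"
  by (rule dot_lin_a lin_compose[OF ast_lin_a dot_lin_u])+

text \<open>The inductive equation defining the products, freed from words: both sides are linear in
  \<open>v\<close>, and on a word it is the second equation of \<open>ast_word\<close>, as reversal
  puts the last letters in front.\<close>

lemma ast_dot:
  "asp u a (dt v b z) =
    linear_extension sAA UNIV tAA sT (\<lambda>(c, d). dt (asp u d v) c z) (\<Phi> (tAA (a, b)))"
proof (rule TAV_eq_words[OF T lin_compose[OF dot_lin_u ast_lin_v]])
  show "lin sT sT (\<lambda>v. linear_extension sAA UNIV tAA sT (\<lambda>(c, d). dt (asp u d v) c z) (\<Phi> (tAA (a, b))))"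
    by (intro tensor_product_extension_param[OF AA ast_step_lin] lin_compose[OF ast_lin_v dot_lin_u])
qed (simp add: ast_word dot_word)

text \<open>On pure tensors \<star> factors through this map: \<Phi> is applied to the two factors
  from A, and \<open>spread u v\<close> then sends \<open>c\<close> to the outer factor and
  \<open>d\<close> to the index of the product of \<open>u\<close> and \<open>v\<close>.\<close>

definition spread where
  "spread u v = linear_extension sAA UNIV tAA sTA (\<lambda>(c, d). tTA (asp u d v, c))"

lemma spread_aux: "lin sA sTA (\<lambda>c. tTA (asp u d v, c))" "lin sA sTA (\<lambda>d. tTA (asp u d v, c))"
  by (rule tTA_lin2 lin_compose[OF ast_lin_a tTA_lin1])+

lemma spread_lin: "lin sAA sTA (spread u v)"
  and spread_tensor: "spread u v (tAA (c, d)) = tTA (asp u d v, c)"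
  unfolding spread_def
  by (rule lin_tensor_product_extension[OF AA spread_aux] tensor_product_extension_tensor[OF AA spread_aux])+

lemma spread_lin_u: "lin sT sTA (\<lambda>u. spread u v X)"
  unfolding spread_def
  by (intro tensor_product_extension_param[OF AA spread_aux] lin_compose[OF ast_lin_u tTA_lin1])

lemma spread_lin_v: "lin sT sTA (\<lambda>v. spread u v X)"
  unfolding spread_def
  by (intro tensor_product_extension_param[OF AA spread_aux] lin_compose[OF ast_lin_v tTA_lin1])

lemma star_def': "p \<star> q = linear_extension sTA UNIV tTA sTA
    (\<lambda>(u, a). linear_extension sTA UNIV tTA sTA (\<lambda>(v, b). spread u v (\<Phi> (tAA (a, b)))) q) p"
  by (simp add: star_def spread_def)

lemma star_inner: "lin sA sTA (\<lambda>b. spread u v (\<Phi> (tAA (a, b))))" "lin sA sTA (\<lambda>a. spread u v (\<Phi> (tAA (a, b))))"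
  by (rule lin_compose[OF Phi_lin1 spread_lin] lin_compose[OF Phi_lin2 spread_lin])+

lemma star_outer:
  "lin sT sTA (\<lambda>u. linear_extension sTA UNIV tTA sTA (\<lambda>(v, b). spread u v (\<Phi> (tAA (a, b)))) q)"
  "lin sA sTA (\<lambda>a. linear_extension sTA UNIV tTA sTA (\<lambda>(v, b). spread u v (\<Phi> (tAA (a, b)))) q)"
  by (rule tensor_product_extension_param[OF TA spread_lin_v star_inner(1)] spread_lin_u star_inner)+

lemma star_lin1: "lin sTA sTA (\<lambda>p. p \<star> q)"
  unfolding star_def' by (rule lin_tensor_product_extension[OF TA star_outer])

lemma star_lin2: "lin sTA sTA (\<lambda>q. p \<star> q)"
  unfolding star_def'
  by (rule tensor_product_extension_param[OF TA star_outer])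
    (rule lin_tensor_product_extension[OF TA spread_lin_v star_inner(1)])

lemma star_tensor: "tTA (u, a) \<star> tTA (v, b) = spread u v (\<Phi> (tAA (a, b)))"
  unfolding star_def'
  by (subst tensor_product_extension_tensor[OF TA star_outer])
    (rule tensor_product_extension_tensor[OF TA spread_lin_v star_inner(1)])

section \<open>Associativity\<close>

definition pre where "pre a = linear_extension sAA UNIV tAA sA3 (\<lambda>(d, e). tA3 (a, d, e))"
definition post where "post c = linear_extension sAA UNIV tAA sA3 (\<lambda>(d, e). tA3 (d, e, c))"

lemma pre_lin: "lin sAA sA3 (pre a)" and pre_tensor: "pre a (tAA (b, c)) = tA3 (a, b, c)"
  and post_lin: "lin sAA sA3 (post a)" and post_tensor: "post a (tAA (b, c)) = tA3 (b, c, a)"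
  unfolding pre_def post_def
  by (rule lin_tensor_product_extension[OF AA] tensor_product_extension_tensor[OF AA]
      tA3_lin1 tA3_lin2 tA3_lin3)+

lemma pre_lin_a: "lin sA sA3 (\<lambda>a. pre a X)"
  unfolding pre_def by (rule tensor_product_extension_param[OF AA tA3_lin2 tA3_lin3 tA3_lin1])

lemma post_lin_a: "lin sA sA3 (\<lambda>a. post a X)"
  unfolding post_def by (rule tensor_product_extension_param[OF AA tA3_lin1 tA3_lin2 tA3_lin3])

lemma
  assumes F: "lin sAA sAA F"
  shows Id_tensor_lin: "lin sA3 sA3 (Id_tensor sAA tAA sA3 tA3 F)"
    and Id_tensor_tensor: "Id_tensor sAA tAA sA3 tA3 F (tA3 (a, b, c)) = pre a (F (tAA (b, c)))"
    and tensor_Id_lin: "lin sA3 sA3 (tensor_Id sAA tAA sA3 tA3 F)"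
    and tensor_Id_tensor: "tensor_Id sAA tAA sA3 tA3 F (tA3 (a, b, c)) = post c (F (tAA (a, b)))"
proof -
  note F1 = lin_compose[OF tAA_lin1 F] and F2 = lin_compose[OF tAA_lin2 F]
  have 1: "lin sA sA3 (\<lambda>b. pre a (F (tAA (b, c))))" for a c by (rule lin_compose[OF F1 pre_lin])
  have 2: "lin sA sA3 (\<lambda>c. pre a (F (tAA (b, c))))" for a b by (rule lin_compose[OF F2 pre_lin])
  have 3: "lin sA sA3 (\<lambda>a. post c (F (tAA (a, b))))" for b c by (rule lin_compose[OF F1 post_lin])
  have 4: "lin sA sA3 (\<lambda>b. post c (F (tAA (a, b))))" for a c by (rule lin_compose[OF F2 post_lin])
  note E = tensor_cube_extension[OF A3 pre_lin_a 1 2] and E' = tensor_cube_extension[OF A3 3 4 post_lin_a]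
  show "lin sA3 sA3 (Id_tensor sAA tAA sA3 tA3 F)"
    unfolding Id_tensor_def pre_def[symmetric] by (rule E(1))
  show "Id_tensor sAA tAA sA3 tA3 F (tA3 (a, b, c)) = pre a (F (tAA (b, c)))"
    unfolding Id_tensor_def pre_def[symmetric] by (rule E(2))
  show "lin sA3 sA3 (tensor_Id sAA tAA sA3 tA3 F)"
    unfolding tensor_Id_def post_def[symmetric] by (rule E'(1))
  show "tensor_Id sAA tAA sA3 tA3 F (tA3 (a, b, c)) = post c (F (tAA (a, b)))"
    unfolding tensor_Id_def post_def[symmetric] by (rule E'(2))
qed

lemma flip_lin: "lin sAA sAA (flip sAA tAA)" and flip_tensor: "flip sAA tAA (tAA (a, b)) = tAA (b, a)"
  unfolding flip_def
  by (rule lin_tensor_product_extension[OF AA] tensor_product_extension_tensor[OF AA]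
      tAA_lin1 tAA_lin2)+

abbreviation I\<Phi> where "I\<Phi> \<equiv> Id_tensor sAA tAA sA3 tA3 \<Phi>"
abbreviation \<Phi>I where "\<Phi>I \<equiv> tensor_Id sAA tAA sA3 tA3 \<Phi>"
abbreviation I\<tau> where "I\<tau> \<equiv> Id_tensor sAA tAA sA3 tA3 (flip sAA tAA)"

lemma leas_eq: "I\<Phi> (\<Phi>I (I\<Phi> X)) = \<Phi>I (I\<tau> (\<Phi>I X))"
  using leas by (simp add: lEAS_def Let_def fun_eq_iff)

lemmas IPhi = Id_tensor_lin[OF linear_Phi] Id_tensor_tensor[OF linear_Phi]
  and PhiI = tensor_Id_lin[OF linear_Phi] tensor_Id_tensor[OF linear_Phi]
  and Itau = Id_tensor_lin[OF flip_lin] Id_tensor_tensor[OF flip_lin]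

lemma spread_letter: "spread u (w ([], [z])) (tAA (c, d)) = tTA (dt u d z, c)"
  by (simp add: spread_tensor ast_letter)

text \<open>A common shape for both bracketings of a product of three factors whose last word is the
  letter \<open>z\<close>: what remains of them is an element of the cube of A, fed to this one
  map.\<close>

definition triple where
  "triple u v z = linear_extension sA3 UNIV tA3 sTA (\<lambda>(e, g, h). tTA (dt (asp u h v) g z, e))"

lemma triple_lin: "lin sA3 sTA (triple u v z)"
  and triple_tensor: "triple u v z (tA3 (e, g, h)) = tTA (dt (asp u h v) g z, e)"
proof -
  have g: "lin sA sTA (\<lambda>g. tTA (dt (asp u h v) g z, e))" for e h
    by (rule lin_compose[OF dot_lin_a tTA_lin1])
  have h: "lin sA sTA (\<lambda>h. tTA (dt (asp u h v) g z, e))" for e g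
    by (rule lin_compose[OF ast_step_lin(2) tTA_lin1])
  note E = tensor_cube_extension[OF A3 tTA_lin2 g h]
  show "lin sA3 sTA (triple u v z)" unfolding triple_def by (rule E(1))
  show "triple u v z (tA3 (e, g, h)) = tTA (dt (asp u h v) g z, e)" unfolding triple_def by (rule E(2))
qed

text \<open>Here \<open>X\<close> stands for the inner \<Phi> (b \<otimes> c). Multiplying by u
  \<otimes> a applies \<Phi> to \<open>a\<close> and the first leg of \<open>X\<close>; the
  recursion of the product at the last letter \<open>z\<close> then applies \<Phi> to the resulting
  second leg and the second leg of \<open>X\<close>.\<close>

lemma star_assoc_letter_aux1:
  "tTA (u, a) \<star> spread v (w ([], [z])) X = triple u v z (I\<Phi> (\<Phi>I (pre a X)))"
proof (rule tensor_product_eq[OF AA])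
  show "lin sAA sTA (\<lambda>X. tTA (u, a) \<star> spread v (w ([], [z])) X)"
    by (rule lin_compose[OF spread_lin star_lin2])
  show "lin sAA sTA (\<lambda>X. triple u v z (I\<Phi> (\<Phi>I (pre a X))))"
    by (rule lin_compose[OF lin_compose[OF lin_compose[OF pre_lin PhiI(1)] IPhi(1)] triple_lin])
next
  fix c d
  have "spread u (dt v d z) Y = triple u v z (I\<Phi> (post d Y))" for Y
  proof (rule tensor_product_eq[OF AA spread_lin lin_compose[OF lin_compose[OF post_lin IPhi(1)] triple_lin]])
    fix e f
    have "tTA (linear_extension sAA UNIV tAA sT (\<lambda>(c, d). dt (asp u d v) c z) Z, e)
      = triple u v z (pre e Z)" for Z
      by (rule tensor_product_eq[OF AA
            lin_compose[OF lin_tensor_product_extension[OF AA ast_step_lin] tTA_lin1]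
            lin_compose[OF pre_lin triple_lin]])
         (simp add: tensor_product_extension_tensor[OF AA ast_step_lin] pre_tensor triple_tensor)
    then show "spread u (dt v d z) (tAA (e, f)) = triple u v z (I\<Phi> (post d (tAA (e, f))))"
      by (simp add: spread_tensor ast_dot post_tensor IPhi(2))
  qed
  then show "tTA (u, a) \<star> spread v (w ([], [z])) (tAA (c, d))
      = triple u v z (I\<Phi> (\<Phi>I (pre a (tAA (c, d)))))"
    by (simp add: spread_letter star_tensor pre_tensor PhiI(2))
qed

text \<open>The first leg of \<open>X\<close> remains the outer factor and meets \<open>c\<close>,
  while the second leg is already the index of the product of \<open>u\<close> and \<open>v\<close>.
  The flip brings \<open>c\<close> next to the first leg before \<Phi> acts.\<close>

lemma star_assoc_letter_aux2:
  "spread u v X \<star> tTA (w ([], [z]), c) = triple u v z (\<Phi>I (I\<tau> (post c X)))"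
proof (rule tensor_product_eq[OF AA])
  show "lin sAA sTA (\<lambda>X. spread u v X \<star> tTA (w ([], [z]), c))"
    by (rule lin_compose[OF spread_lin star_lin1])
  show "lin sAA sTA (\<lambda>X. triple u v z (\<Phi>I (I\<tau> (post c X))))"
    by (rule lin_compose[OF lin_compose[OF lin_compose[OF post_lin Itau(1)] PhiI(1)] triple_lin])
next
  fix c' d
  have "spread (asp u d v) (w ([], [z])) Y = triple u v z (post d Y)" for Y
    by (rule tensor_product_eq[OF AA spread_lin lin_compose[OF post_lin triple_lin]])
      (simp add: spread_letter post_tensor triple_tensor)
  then show "spread u v (tAA (c', d)) \<star> tTA (w ([], [z]), c)
      = triple u v z (\<Phi>I (I\<tau> (post c (tAA (c', d)))))"
    by (simp add: spread_tensor star_tensor post_tensor pre_tensor Itau(2) flip_tensor PhiI(2))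
qed

text \<open>With a last factor of length one, associativity is the lEAS equation mapped forward by \<open>triple\<close>;
  this case already gives \<open>g (us @ vs) = g us \<star> g vs\<close> for left-normed products.\<close>

lemma star_assoc_letter:
  "p \<star> (q \<star> tTA (w ([], [z]), c)) = (p \<star> q) \<star> tTA (w ([], [z]), c)"
proof (rule tensor_product_eq[OF TA star_lin1 lin_compose[OF star_lin1 star_lin1]])
  fix u a
  show "tTA (u, a) \<star> (q \<star> tTA (w ([], [z]), c)) = (tTA (u, a) \<star> q) \<star> tTA (w ([], [z]), c)"
  proof (rule tensor_product_eq[OF TA lin_compose[OF star_lin1 star_lin2] lin_compose[OF star_lin2 star_lin1]])
    fix v b
    show "tTA (u, a) \<star> (tTA (v, b) \<star> tTA (w ([], [z]), c))
        = (tTA (u, a) \<star> tTA (v, b)) \<star> tTA (w ([], [z]), c)"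
      using leas_eq[of "tA3 (a, b, c)"]
      by (simp add: star_tensor star_assoc_letter_aux1 star_assoc_letter_aux2 IPhi(2) PhiI(2))
  qed
qed

section \<open>The subalgebra generated by V \<otimes> A\<close>

abbreviation VA where "VA \<equiv> V_tensor_A w sTA tTA"

lemma VA_induct [consumes 1, case_names zero step]:
  assumes "g \<in> VA" "P 0"
    "\<And>c x a g. P g \<Longrightarrow> P (sTA c (tTA (w ([], [x]), a)) + g)"
  shows "P g"
proof -
  interpret TA: vector_space sTA by (rule vsTA)
  show ?thesis
    using assms(1) unfolding V_tensor_A_def
    by (induction rule: TA.span_induct_alt) (auto simp: assms(2,3))
qed

lemma star_assoc:
  assumes "g \<in> VA" shows "p \<star> (q \<star> g) = (p \<star> q) \<star> g"
  using assms
  by (induction rule: VA_induct)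
    (simp_all add: lin_add[OF star_lin2] lin_scale[OF star_lin2] lin_zero[OF star_lin2] star_assoc_letter)

abbreviation letter where "letter x a \<equiv> tTA (w ([], [x]), a)"
abbreviation S where "S \<equiv> generated_subalgebra sTA str VA"

interpretation TA: vector_space sTA by (rule vsTA)
interpretation A: vector_space sA by (rule vsA)
interpretation AA: vector_space sAA by (rule vsAA)

lemma subalgebra_S: "subalgebra sTA str S"
  unfolding generated_subalgebra_def
  by (rule hull_in) (auto simp: subalgebra_def intro: TA.subspace_Inter)

lemma S_minimal: "VA \<subseteq> W \<Longrightarrow> subalgebra sTA str W \<Longrightarrow> S \<subseteq> W"
  unfolding generated_subalgebra_def by (rule hull_minimal)

lemma VA_subset_S: "VA \<subseteq> S"
  unfolding generated_subalgebra_def by (rule hull_subset)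

lemma letter_VA: "letter x a \<in> VA"
  unfolding V_tensor_A_def by (rule TA.span_base) blast

lemma letter_S: "letter x a \<in> S"
  using letter_VA VA_subset_S by blast

lemma subspace_VA: "TA.subspace VA"
  by (simp add: V_tensor_A_def)

lemma VA_subsetI: "TA.subspace W \<Longrightarrow> (\<And>x a. letter x a \<in> W) \<Longrightarrow> VA \<subseteq> W"
  unfolding V_tensor_A_def by (rule TA.span_minimal) auto

lemma S_star: "p \<in> S \<Longrightarrow> q \<in> S \<Longrightarrow> p \<star> q \<in> S"
  and subspace_S: "TA.subspace S"
  using subalgebra_S by (auto simp: subalgebra_def)

section \<open>Components of degree one and two\<close>

text \<open>Every product ends with letters appended by \<open>dot\<close>, so it has no component
  of length one.\<close>

lemma dot_kernel_ast:
  assumes f: "lin sT sC f" and f0: "\<And>u a x. f (dt u a x) = 0"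
  shows "f (asp u d v) = 0"
proof (rule word_eq[OF lin_compose[OF ast_lin_v f] lin_0[OF vsT]])
  show vsC: "vector_space sC" using f by (simp add: lin_iff)
  show "f (asp u d (w ([], [x]))) = 0" for x by (simp add: ast_letter f0)
  have "f (linear_extension sAA UNIV tAA sT (\<lambda>(c, d). dt (asp u d v) c z) X) = 0" for v z X
    by (rule tensor_product_eq[OF AA lin_compose[OF lin_tensor_product_extension[OF AA ast_step_lin] f]
          lin_0[OF vsAA vsC]])
      (simp add: tensor_product_extension_tensor[OF AA ast_step_lin] f0)
  then show "f (asp u d (dt v b z)) = 0" for v b z by (simp add: ast_dot)
qed

text \<open>\<open>\<eta>\<close> and \<open>\<pi>\<close> are the projections to length one and
  length two, with \<psi> applied to each vector. A product of words of lengths m and n has length m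
  + n, so \<open>\<eta>\<close> kills products, and only the length one parts of the factors
  contribute to \<open>\<pi>\<close>.\<close>

lemma degree_projections:
  assumes \<psi>: "lin sV (*) \<psi>"
  obtains \<eta> \<pi> where "lin sTA sA \<eta>" "\<And>x a. \<eta> (letter x a) = sA (\<psi> x) a" "\<And>p q. \<eta> (p \<star> q) = 0"
    "lin sTA sAA \<pi>" "\<And>x a. \<pi> (letter x a) = 0"
    "\<And>x y c d. \<pi> (tTA (w ([d], [x, y]), c)) = sAA (\<psi> x * \<psi> y) (tAA (c, d))"
    "\<And>p q. \<pi> (p \<star> q) = \<Phi> (tAA (\<eta> p, \<eta> q))"
proof -
  obtain f where f: "lin sT (*) f" "\<And>x. f (w ([], [x])) = \<psi> x" "\<And>u a x. f (dt u a x) = 0"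
    by (rule word_recursion[OF \<psi>, of "\<lambda>_ _ _. 0"]) (auto intro: lin_0 vsT vsA vsV vector_space_mult)
  note f_ast = dot_kernel_ast[OF f(1,3)]
  \<comment> \<open>The factor \<open>f u\<close> vanishes unless \<open>u\<close> has a component
    of length one, so \<open>g\<close> extracts the middle letter from words of length two and kills
    all others.\<close>
  obtain g where g: "lin sT sA g" "\<And>x. g (w ([], [x])) = 0" "\<And>u a x. g (dt u a x) = sA (f u * \<psi> x) a"
    by (rule word_recursion[OF lin_0[OF vsV vsA], of "\<lambda>u a x. sA (f u * \<psi> x) a"])
      (auto simp: lin_iff vsT vsA vsV lin_add[OF f(1)] lin_scale[OF f(1)] lin_add[OF \<psi>] lin_scale[OF \<psi>]
        algebra_simps)
  have g_ast: "g (asp u d v) = sA (f u * f v) d" for u d v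
  proof (rule word_eq[OF lin_compose[OF ast_lin_v g(1)]])
    show "lin sT sA (\<lambda>v. sA (f u * f v) d)"
      by (simp add: lin_iff vsT vsA lin_add[OF f(1)] lin_scale[OF f(1)] algebra_simps)
    show "g (asp u d (w ([], [x]))) = sA (f u * f (w ([], [x]))) d" for x
      by (simp add: ast_letter f g)
    have "g (linear_extension sAA UNIV tAA sT (\<lambda>(c, d). dt (asp u d v) c z) X) = 0" for v z X
      by (rule tensor_product_eq[OF AA lin_compose[OF lin_tensor_product_extension[OF AA ast_step_lin] g(1)]
            lin_0[OF vsAA vsA]])
        (simp add: tensor_product_extension_tensor[OF AA ast_step_lin] g f_ast)
    then show "g (asp u d (dt v b z)) = sA (f u * f (dt v b z)) d" for v b z
      by (simp add: ast_dot f)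
  qed
  define \<eta> where "\<eta> = linear_extension sTA UNIV tTA sA (\<lambda>(u, a). sA (f u) a)"
  have e: "lin sT sA (\<lambda>u. sA (f u) a)" "lin sA sA (\<lambda>a. sA (f u) a)" for u a
    by (simp_all add: lin_iff vsT vsA lin_add[OF f(1)] lin_scale[OF f(1)] algebra_simps)
  have \<eta>: "lin sTA sA \<eta>" "\<And>u a. \<eta> (tTA (u, a)) = sA (f u) a"
    unfolding \<eta>_def by (rule tensor_product_extension[OF TA e])+
  \<comment> \<open>The outer factor goes first: \<open>spread\<close> puts the first leg of \<Phi>
    outside and the second inside the word, and this order restores it.\<close>
  define \<pi> where "\<pi> = linear_extension sTA UNIV tTA sAA (\<lambda>(u, c). tAA (c, g u))"
  have \<pi>: "lin sTA sAA \<pi>" "\<And>u c. \<pi> (tTA (u, c)) = tAA (c, g u)"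
    unfolding \<pi>_def by (rule tensor_product_extension[OF TA lin_compose[OF g(1) tAA_lin2] tAA_lin1])+
  have \<eta>_star: "\<eta> (p \<star> q) = 0" for p q
  proof (rule tensor_product_eq[OF TA lin_compose[OF star_lin1 \<eta>(1)] lin_0[OF vsTA vsA]],
      rule tensor_product_eq[OF TA lin_compose[OF star_lin2 \<eta>(1)] lin_0[OF vsTA vsA]])
    fix u a v b
    have "\<eta> (spread u v X) = 0" for X
      by (rule tensor_product_eq[OF AA lin_compose[OF spread_lin \<eta>(1)] lin_0[OF vsAA vsA]])
        (simp add: spread_tensor \<eta> f_ast)
    then show "\<eta> (tTA (u, a) \<star> tTA (v, b)) = 0" by (simp add: star_tensor)
  qed
  have r1: "lin sTA sAA (\<lambda>p. \<Phi> (tAA (\<eta> p, b)))" and r2: "lin sTA sAA (\<lambda>p. \<Phi> (tAA (b, \<eta> p)))" for b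
    by (rule lin_compose[OF \<eta>(1) Phi_lin1] lin_compose[OF \<eta>(1) Phi_lin2])+
  have \<pi>_star: "\<pi> (p \<star> q) = \<Phi> (tAA (\<eta> p, \<eta> q))" for p q
  proof (rule tensor_product_eq[OF TA lin_compose[OF star_lin1 \<pi>(1)] r1],
      rule tensor_product_eq[OF TA lin_compose[OF star_lin2 \<pi>(1)] r2])
    fix u a v b
    have "\<pi> (spread u v X) = sAA (f u * f v) X" for X
      by (rule tensor_product_eq[OF AA lin_compose[OF spread_lin \<pi>(1)] lin_scaled[OF lin_id[OF vsAA]]])
        (simp add: spread_tensor \<pi> g_ast lin_scale[OF tAA_lin2])
    then show "\<pi> (tTA (u, a) \<star> tTA (v, b)) = \<Phi> (tAA (\<eta> (tTA (u, a)), \<eta> (tTA (v, b))))"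
      by (simp add: star_tensor \<eta> lin_scale[OF Phi_lin1] lin_scale[OF Phi_lin2])
  qed
  have two: "w ([d], [x, y]) = dt (w ([], [x])) d y" for d x y
    by (simp add: dot_word)
  show ?thesis
    by (rule that[OF \<eta>(1) _ \<eta>_star \<pi>(1) _ _ \<pi>_star])
      (simp_all add: \<eta> \<pi> f g two lin_zero[OF tAA_lin2] lin_scale[OF tAA_lin2])
qed

section \<open>Generation\<close>

text \<open>The elements that \<open>\<pi>\<close> maps into the range of \<Phi> form a subalgebra
  containing V \<otimes> A, hence are all elements. The word x0 d x0 with outer factor
  \<open>c\<close> is mapped to c \<otimes> d, so every pure tensor lies in the range.\<close>

lemma surj_if_generated:
  fixes x0 :: 'v
  assumes "x0 \<noteq> 0" and gen: "S = UNIV"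
  shows "surj \<Phi>"
proof -
  obtain \<psi> where \<psi>: "lin sV (*) \<psi>" "\<psi> x0 = 1" by (rule functional_exists[OF vsV assms(1)])
  obtain \<eta> \<pi> where \<pi>: "lin sTA sAA \<pi>" "\<And>x a. \<pi> (letter x a) = 0"
    "\<And>x y c d. \<pi> (tTA (w ([d], [x, y]), c)) = sAA (\<psi> x * \<psi> y) (tAA (c, d))"
    "\<And>p q. \<pi> (p \<star> q) = \<Phi> (tAA (\<eta> p, \<eta> q))"
    by (rule degree_projections[OF \<psi>(1)]) blast
  interpret \<pi>: Vector_Spaces.linear sTA sAA \<pi> by (rule \<pi>(1))
  interpret \<Phi>: Vector_Spaces.linear sAA sAA \<Phi> by (rule linear_Phi)
  have sub: "AA.subspace (range \<Phi>)" by (rule \<Phi>.subspace_image) simp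
  have "subalgebra sTA str {p. \<pi> p \<in> range \<Phi>}"
    using \<pi>.subspace_linear_preimage[OF sub] by (simp add: subalgebra_def \<pi>(4))
  moreover have "VA \<subseteq> {p. \<pi> p \<in> range \<Phi>}"
    using AA.subspace_0[OF sub]
    by (intro VA_subsetI \<pi>.subspace_linear_preimage[OF sub]) (simp add: \<pi>(2))
  ultimately have *: "\<pi> p \<in> range \<Phi>" for p
    using S_minimal gen by blast
  have "tAA (c, d) \<in> range \<Phi>" for c d
    using *[of "tTA (w ([d], [x0, x0]), c)"] \<pi>(3) \<psi>(2) by simp
  then have "range tAA \<subseteq> range \<Phi>" by auto
  from AA.span_minimal[OF this sub] show ?thesis
    using tensor_product_span[OF AA] by blast
qed

text \<open>For a pure tensor \<open>X\<close> this element is a product of some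
  \<open>tTA (u, a)\<close> with a letter. A general \<open>X\<close> is needed because the preimage
  of a pure tensor under \<Phi> need not be pure.\<close>

lemma spread_Phi_S:
  assumes "\<And>a. tTA (u, a) \<in> S" shows "spread u (w ([], [x])) (\<Phi> X) \<in> S"
  using tensor_product_span[OF AA, of X]
proof (induction rule: AA.span_induct_alt)
  case base
  show ?case using TA.subspace_0[OF subspace_S] by (simp add: lin_zero[OF linear_Phi] lin_zero[OF spread_lin])
next
  case (step c X Y)
  then obtain a b where X: "X = tAA (a, b)" by auto
  have "spread u (w ([], [x])) (\<Phi> X) \<in> S"
    using S_star[OF assms[of a] letter_S[of x b]] by (simp add: X star_tensor)
  with step show ?case
    by (simp add: lin_add[OF linear_Phi] lin_add[OF spread_lin] lin_scale[OF linear_Phi] lin_scale[OF spread_lin]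
        TA.subspace_add TA.subspace_scale subspace_S)
qed

lemma generated_if_surj:
  assumes "surj \<Phi>" shows "S = UNIV"
proof -
  have word: "tTA (w (as, xs), a) \<in> S" if "length xs = Suc (length as)" for as xs a
    using that
  proof (induction as arbitrary: xs a rule: rev_induct)
    case Nil
    then show ?case using letter_S by (auto simp: length_Suc_conv)
  next
    case (snoc d as)
    then obtain xs' x where xs: "xs = xs' @ [x]" by (cases xs rule: rev_cases) auto
    \<comment> \<open>Surjectivity enters here: the outer factor \<open>a\<close> and the last inner
      letter \<open>d\<close> are together written as a value of \<Phi>, which exhibits the word as
      a sum of products with shorter left factors.\<close>
    obtain X where X: "tAA (a, d) = \<Phi> X" using assms by (metis surjD)
    have "tTA (w (as @ [d], xs), a) = spread (w (as, xs')) (w ([], [x])) (\<Phi> X)"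
      using snoc.prems xs by (simp add: spread_letter dot_word flip: X)
    then show ?case using snoc xs by (simp add: spread_Phi_S)
  qed
  have "tTA (u, a) \<in> S" for u a
  proof -
    interpret T: vector_space sT by (rule vsT)
    have "u \<in> T.span (w ` TAV_words)"
      using presents_span[OF T[unfolded TAV_def]] by blast
    then show ?thesis
      by (induction rule: T.span_induct_alt)
        (use word in \<open>auto simp: lin_zero[OF tTA_lin1] lin_add[OF tTA_lin1] lin_scale[OF tTA_lin1]
          TAV_words_def intro!: TA.subspace_0 TA.subspace_add TA.subspace_scale subspace_S\<close>)
  qed
  then have "range tTA \<subseteq> S" by auto
  from TA.span_minimal[OF this subspace_S] show ?thesis
    using tensor_product_span[OF TA] by blast
qed

section \<open>Freeness\<close>

text \<open>Nothing is known about the degrees of the free generators \<open>U\<close>. It suffices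
  that \<open>\<eta>\<close> kills products, hence kills \<open>g us\<close> unless
  \<open>us\<close> is a single letter; words of length two in \<open>U\<close> then carry all the
  information about \<open>\<eta> p\<close> and \<open>\<eta> q\<close>.\<close>

lemma inj_if_free:
  fixes x0 :: 'v
  assumes "x0 \<noteq> 0" and free: "free_nonunital_algebra sTA str S"
  shows "inj \<Phi>"
proof -
  obtain \<psi> where \<psi>: "lin sV (*) \<psi>" "\<psi> x0 = 1" by (rule functional_exists[OF vsV assms(1)])
  obtain \<eta> where \<eta>: "lin sTA sA \<eta>" "\<And>x a. \<eta> (letter x a) = sA (\<psi> x) a" "\<And>p q. \<eta> (p \<star> q) = 0"
    by (rule degree_projections[OF \<psi>(1)]) blast
  obtain U g where U: "TA.subspace U"
    and P: "presents sTA S (lists U - {[]}) g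
          (\<Union>us\<in>lists U. \<Union>vs\<in>lists U. slot_relations sTA U (\<lambda>u. us @ u # vs))"
    and g: "\<And>us vs. us \<in> lists U - {[]} \<Longrightarrow> vs \<in> lists U - {[]} \<Longrightarrow> g (us @ vs) = g us \<star> g vs"
    using free unfolding free_nonunital_algebra_def by blast
  \<comment> \<open>The relations with empty context state that \<open>g\<close> is linear on
    one-letter words over \<open>U\<close>.\<close>
  have "\<forall>r\<in>slot_relations sTA U (\<lambda>u. [] @ u # []). lincomb sTA g r = 0"
    using presents_relation[OF P] by blast
  then have g1: "\<And>u v. u \<in> U \<Longrightarrow> v \<in> U \<Longrightarrow> g [u + v] = g [u] + g [v]"
      "\<And>c u. u \<in> U \<Longrightarrow> g [sTA c u] = sTA c (g [u])"
    unfolding slot_relations_iff[OF vsTA] by auto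
  \<comment> \<open>the values on words of a map \<open>m\<close> with \<open>m (p \<star> q) = \<eta> p \<otimes> \<eta> q\<close>, which is left inverse to
    \<open>a \<otimes> b \<mapsto> (x0 \<otimes> a) \<star> (x0 \<otimes> b)\<close>\<close>
  define f where "f us = (if length us = 2 then tAA (\<eta> (g [us ! 0]), \<eta> (g [us ! 1])) else 0)" for us
  have "\<forall>r\<in>slot_relations sTA U (\<lambda>u. us @ u # vs). lincomb sAA f r = 0" for us vs
  \<comment> \<open>The word \<open>us @ u # vs\<close> has length two exactly in this case;
    otherwise \<open>f\<close> is constantly 0 on the slot.\<close>
  proof (cases "length us + length vs = 1")
    case True
    then consider a where "us = [a]" "vs = []" | b where "us = []" "vs = [b]"
      by (cases us; cases vs) auto
    then show ?thesis
      unfolding slot_relations_iff[OF vsAA]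
      by cases (simp_all add: f_def g1 lin_add[OF \<eta>(1)] lin_scale[OF \<eta>(1)]
          lin_add[OF tAA_lin1] lin_scale[OF tAA_lin1] lin_add[OF tAA_lin2] lin_scale[OF tAA_lin2])
  next
    case False
    then show ?thesis unfolding slot_relations_iff[OF vsAA] by (simp add: f_def)
  qed
  then obtain m where m: "lin sTA sAA m" "\<And>us. us \<in> lists U - {[]} \<Longrightarrow> m (g us) = f us"
    using presents_linear_exists[OF P vsAA, of f] by blast
  have \<eta>0: "\<eta> (g us) = 0" if "us \<in> lists U - {[]}" "length us \<noteq> 1" for us
  proof -
    from that obtain u v vs where "us = [u] @ (v # vs)" by (cases us; cases "tl us") auto
    then show ?thesis using that g[of "[u]" "v # vs"] \<eta>(3) by auto
  qed
  have m_star: "m (p \<star> q) = tAA (\<eta> p, \<eta> q)" if "p \<in> S" "q \<in> S" for p q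
  proof (rule presents_eq[OF P lin_compose[OF star_lin1 m(1)] lin_compose[OF \<eta>(1) tAA_lin1] that(1)],
      rule presents_eq[OF P lin_compose[OF star_lin2 m(1)] lin_compose[OF \<eta>(1) tAA_lin2] that(2)])
    fix us vs assume us: "us \<in> lists U - {[]}" and vs: "vs \<in> lists U - {[]}"
    have "m (g us \<star> g vs) = f (us @ vs)"
      using us vs m(2)[of "us @ vs"] g[OF us vs] by auto
    also have "\<dots> = tAA (\<eta> (g us), \<eta> (g vs))"
    proof (cases "length us = 1 \<and> length vs = 1")
      case True
      then show ?thesis by (auto simp: f_def length_Suc_conv)
    next
      case False
      then have "tAA (\<eta> (g us), \<eta> (g vs)) = 0"
        using \<eta>0[OF us] \<eta>0[OF vs] lin_zero[OF tAA_lin1] lin_zero[OF tAA_lin2] by metis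
      moreover have "length (us @ vs) \<noteq> 2"
        using False us vs by (cases us; cases vs) auto
      ultimately show ?thesis by (simp add: f_def)
    qed
    finally show "m (g us \<star> g vs) = tAA (\<eta> (g us), \<eta> (g vs))" .
  qed
  \<comment> \<open>This exhibits an explicit left inverse of \<Phi>; both sides are linear in
    \<open>X\<close>, so pure tensors suffice.\<close>
  have "m (spread (w ([], [x0])) (w ([], [x0])) (\<Phi> X)) = X" for X
  proof (rule tensor_product_eq[OF AA lin_compose[OF lin_compose[OF linear_Phi spread_lin] m(1)] lin_id[OF vsAA]])
    fix a b
    show "m (spread (w ([], [x0])) (w ([], [x0])) (\<Phi> (tAA (a, b)))) = tAA (a, b)"
      using m_star[OF letter_S[of x0 a] letter_S[of x0 b]] by (simp add: star_tensor \<eta> \<psi>)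
  qed
  then show ?thesis by (rule inj_on_inverseI)
qed

section \<open>Left-normed products of elements of V \<otimes> A\<close>

definition lprod where "lprod us = foldl str (hd us) (tl us)"

lemma lprod_single [simp]: "lprod [u] = u"
  by (simp add: lprod_def)

lemma lprod_snoc: "us \<noteq> [] \<Longrightarrow> lprod (us @ [u]) = lprod us \<star> u"
  by (simp add: lprod_def)

text \<open>Induction on \<open>vs\<close> from the right: each step detaches a last factor by
  \<open>star_assoc\<close>, which asks for this factor to lie in \<open>VA\<close>.\<close>

lemma lprod_append:
  assumes "us \<noteq> []" "vs \<in> lists VA" "vs \<noteq> []"
  shows "lprod (us @ vs) = lprod us \<star> lprod vs"
  using assms(3,2)
proof (induction vs rule: rev_nonempty_induct)
  case (single v)
  then show ?case by (simp add: lprod_snoc assms(1))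
next
  case (snoc v vs)
  then have "lprod (us @ vs @ [v]) = lprod us \<star> lprod vs \<star> v"
    using lprod_snoc[of "us @ vs" v] assms(1) by simp
  then show ?case using snoc by (simp add: lprod_snoc star_assoc)
qed

lemma lprod_slot: "lin sTA sTA (\<lambda>u. lprod (us @ u # vs))"
proof (induction vs rule: rev_induct)
  case Nil
  show ?case by (cases "us = []") (simp_all add: lprod_snoc star_lin2 lin_id vsTA)
next
  case (snoc v vs)
  have "lprod (us @ u # vs @ [v]) = lprod (us @ u # vs) \<star> v" for u
    using lprod_snoc[of "us @ u # vs"] by simp
  with lin_compose[OF snoc star_lin1] show ?case by simp
qed

text \<open>By \<open>lprod_append\<close>, the span of the nonempty products is closed under
  \<star>, so it is the smallest subalgebra containing V \<otimes> A.\<close>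

lemma S_eq_span_lprod: "S = TA.span (lprod ` (lists VA - {[]}))"
proof
  let ?P = "TA.span (lprod ` (lists VA - {[]}))"
  have gen: "lprod us \<star> q \<in> ?P" if us: "us \<in> lists VA - {[]}" and "q \<in> ?P" for us q
    using that(2)
  proof (induction rule: TA.span_induct_alt)
    case base
    show ?case by (simp add: lin_zero[OF star_lin2] TA.span_zero)
  next
    case (step c x y)
    then obtain vs where vs: "vs \<in> lists VA - {[]}" "x = lprod vs" by blast
    have "us @ vs \<in> lists VA - {[]}" "lprod us \<star> x = lprod (us @ vs)"
      using us vs by (auto simp: lprod_append)
    then have "lprod us \<star> x \<in> ?P" by (metis TA.span_base image_eqI)
    with step show ?case
      by (auto simp: lin_add[OF star_lin2] lin_scale[OF star_lin2] intro: TA.span_add TA.span_scale)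
  qed
  have "p \<star> q \<in> ?P" if "p \<in> ?P" "q \<in> ?P" for p q
    using that(1)
    by (induction rule: TA.span_induct_alt)
      (use gen that(2) in \<open>auto simp: lin_zero[OF star_lin1] lin_add[OF star_lin1] lin_scale[OF star_lin1]
        intro!: TA.span_add TA.span_scale TA.span_zero\<close>)
  moreover have "v \<in> ?P" if "v \<in> VA" for v
    using that by (intro TA.span_base image_eqI[of _ _ "[v]"]) auto
  ultimately show "S \<subseteq> ?P"
    by (intro S_minimal) (auto simp: subalgebra_def)
  have "lprod us \<in> S" if "us \<noteq> []" "us \<in> lists VA" for us
    using that
  proof (induction us rule: rev_nonempty_induct)
    case (single u)
    then show ?case using VA_subset_S by auto
  next
    case (snoc u us)
    then show ?case using VA_subset_S by (auto simp: lprod_snoc intro: S_star)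
  qed
  then show "?P \<subseteq> S" by (intro TA.span_minimal subspace_S) auto
qed

section \<open>Functionals dual to products of basis elements, and freeness\<close>

lemma letter_lin1: "lin sV sTA (\<lambda>x. letter x a)"
  using lin_compose[OF TAV_lin_V[OF T vsA vsV, of "[]" "[]" "[]"] tTA_lin1] by simp

text \<open>\<open>D\<close> sends \<open>(u \<cdot> d y) \<otimes> c\<close> to \<open>\<psi> y\<close> times \<open>u \<otimes> (id \<otimes> \<beta>) (\<Theta> (c \<otimes> d))\<close>, where \<open>\<Theta>\<close> is a left inverse of \<open>\<Phi>\<close>.\<close>

lemma dual_step:
  assumes inj: "inj \<Phi>" and \<psi>: "lin sV (*) \<psi>" and \<beta>: "lin sA (*) \<beta>"
  obtains D where "lin sTA sTA D" "\<And>x a. D (letter x a) = 0"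
    "\<And>p y b. D (p \<star> letter y b) = sTA (\<psi> y * \<beta> b) p"
proof -
  interpret pair: vector_space_pair sAA sAA ..
  obtain \<Theta> where \<Theta>: "lin sAA sAA \<Theta>" "\<And>X. \<Theta> (\<Phi> X) = X"
    using pair.linear_injective_left_inverse[OF linear_Phi inj] by (metis comp_apply id_apply)
  define \<gamma> where "\<gamma> = linear_extension sAA UNIV tAA sA (\<lambda>(a, b). sA (\<beta> b) a)"
  have g: "lin sA sA (\<lambda>a. sA (\<beta> b) a)" "lin sA sA (\<lambda>b. sA (\<beta> b) a)" for a b
    by (simp_all add: lin_iff vsA lin_add[OF \<beta>] lin_scale[OF \<beta>] algebra_simps)
  have \<gamma>: "lin sAA sA \<gamma>" "\<And>a b. \<gamma> (tAA (a, b)) = sA (\<beta> b) a"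
    unfolding \<gamma>_def by (rule tensor_product_extension[OF AA g])+
  define \<kappa> where "\<kappa> X = \<gamma> (\<Theta> X)" for X
  have \<kappa>: "lin sAA sA \<kappa>" unfolding \<kappa>_def by (rule lin_compose[OF \<Theta>(1) \<gamma>(1)])
  have \<kappa>1: "lin sA sTA (\<lambda>c. tTA (u, \<kappa> (tAA (c, d))))" and \<kappa>2: "lin sA sTA (\<lambda>d. tTA (u, \<kappa> (tAA (c, d))))" for u c d
    by (rule lin_compose[OF lin_compose[OF tAA_lin1 \<kappa>] tTA_lin2]
        lin_compose[OF lin_compose[OF tAA_lin2 \<kappa>] tTA_lin2])+
  have "\<exists>L. lin sT sTA L \<and> (\<forall>x. L (w ([], [x])) = 0) \<and>
      (\<forall>u d y. L (dt u d y) = sTA (\<psi> y) (tTA (u, \<kappa> (tAA (c, d)))))" for c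
  proof (rule word_recursion[OF lin_0[OF vsV vsTA], of "\<lambda>u d y. sTA (\<psi> y) (tTA (u, \<kappa> (tAA (c, d))))"])
    show "lin sT sTA (\<lambda>u. sTA (\<psi> x) (tTA (u, \<kappa> (tAA (c, a)))))" for a x
      by (rule lin_scaled[OF tTA_lin1])
    show "lin sA sTA (\<lambda>a. sTA (\<psi> x) (tTA (u, \<kappa> (tAA (c, a)))))" for u x
      by (rule lin_scaled[OF \<kappa>2])
    show "lin sV sTA (\<lambda>x. sTA (\<psi> x) (tTA (u, \<kappa> (tAA (c, a)))))" for u a
      by (rule lin_compose[OF \<psi> lin_smult[OF vsTA]])
  qed blast
  then obtain L where L: "\<And>c. lin sT sTA (L c)" "\<And>c x. L c (w ([], [x])) = 0"
      "\<And>c u d y. L c (dt u d y) = sTA (\<psi> y) (tTA (u, \<kappa> (tAA (c, d))))"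
    by metis
  \<comment> \<open>The maps \<open>L c\<close> were chosen separately for each \<open>c\<close>, so
    linearity in \<open>c\<close> has to come from their uniqueness on words.\<close>
  have Lc: "lin sA sTA (\<lambda>c. L c u)" for u
  proof -
    have "L (c + c') u = L c u + L c' u" for c c'
      by (rule word_eq[OF L(1) lin_plus[OF L(1) L(1)]])
        (simp_all add: L(2,3) lin_add[OF \<kappa>1] TA.scale_right_distrib)
    moreover have "L (sA k c) u = sTA k (L c u)" for k c
      by (rule word_eq[OF L(1) lin_scaled[OF L(1)]])
        (simp_all add: L(2,3) lin_scale[OF \<kappa>1] mult.commute)
    ultimately show ?thesis by (simp add: lin_iff vsA vsTA)
  qed
  define D where "D = linear_extension sTA UNIV tTA sTA (\<lambda>(u, c). L c u)"
  have D: "lin sTA sTA D" "\<And>u c. D (tTA (u, c)) = L c u"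
    unfolding D_def by (rule tensor_product_extension[OF TA L(1) Lc])+
  \<comment> \<open>With \<open>X\<close> = \<Phi> (a \<otimes> b), the left inverse inside
    \<open>\<kappa>\<close> returns a \<otimes> b, and contraction with \<beta> leaves \<beta> b
    times \<open>a\<close>; so u \<otimes> a reappears up to a scalar.\<close>
  have "D (spread u (w ([], [y])) X) = sTA (\<psi> y) (tTA (u, \<kappa> X))" for u y X
    by (rule tensor_product_eq[OF AA lin_compose[OF spread_lin D(1)]
          lin_scaled[OF lin_compose[OF \<kappa> tTA_lin2]]]) (simp add: spread_letter D(2) L(3))
  then have "D (tTA (u, a) \<star> letter y b) = sTA (\<psi> y * \<beta> b) (tTA (u, a))" for u a y b
    by (simp add: star_tensor \<kappa>_def \<Theta>(2) \<gamma>(2) lin_scale[OF tTA_lin2])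
  then have "D (p \<star> letter y b) = sTA (\<psi> y * \<beta> b) p" for p y b
    by (rule tensor_product_eq[OF TA lin_compose[OF star_lin1 D(1)] lin_scaled[OF lin_id[OF vsTA]]])
  with D L(2) that show ?thesis by metis
qed

text \<open>For a single letter, \<open>\<eta>\<close> kills all longer products and the coordinate
  functionals decide the rest. To append a letter \<open>i\<close>, the functional for the shorter
  word is preceded by the operator \<open>D\<close> for \<open>i\<close>, which strips a last letter
  equal to \<open>i\<close> and gives 0 for any other basis letter. Words of length one are killed
  by \<open>D\<close>, as they must be since \<open>W @ [i]\<close> is longer.\<close>

lemma word_functional:
  assumes inj: "inj \<Phi>"
    and \<psi>: "\<And>x. lin sV (*) (\<psi> x)" "\<And>x y. x \<in> B \<Longrightarrow> y \<in> B \<Longrightarrow> \<psi> x y = (if y = x then 1 else 0)"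
    and \<beta>: "\<And>a. lin sA (*) (\<beta> a)" "\<And>a b. a \<in> C \<Longrightarrow> b \<in> C \<Longrightarrow> \<beta> a b = (if b = a then 1 else 0)"
    and W: "W \<in> lists (B \<times> C)" "W \<noteq> []"
  shows "\<exists>F. lin sTA (*) F \<and> (\<forall>W'\<in>lists (B \<times> C). W' \<noteq> [] \<longrightarrow>
    F (lprod (map (\<lambda>(x, a). letter x a) W')) = (if W' = W then 1 else 0))"
  using W(2,1)
proof (induction W rule: rev_nonempty_induct)
  case (single i)
  then obtain x a where i: "i = (x, a)" "x \<in> B" "a \<in> C" by auto
  obtain \<eta> where \<eta>: "lin sTA sA \<eta>" "\<And>y a. \<eta> (letter y a) = sA (\<psi> x y) a" "\<And>p q. \<eta> (p \<star> q) = 0"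
    by (rule degree_projections[OF \<psi>(1)[of x]]) blast
  show ?case
  proof (intro exI conjI ballI impI)
    show "lin sTA (*) (\<lambda>p. \<beta> a (\<eta> p))" by (rule lin_compose[OF \<eta>(1) \<beta>(1)])
    fix W' assume W': "W' \<in> lists (B \<times> C)" "W' \<noteq> []"
    from W'(2) obtain V y b where V: "W' = V @ [(y, b)]" by (metis rev_exhaust surj_pair)
    show "\<beta> a (\<eta> (lprod (map (\<lambda>(x, a). letter x a) W'))) = (if W' = [i] then 1 else 0)"
    proof (cases "V = []")
      case True
      then show ?thesis using V W' i \<psi>(2) \<beta>(2) by (auto simp: \<eta> lin_scale[OF \<beta>(1)])
    next
      case False
      then show ?thesis using V by (simp add: lprod_snoc \<eta> lin_zero[OF \<beta>(1)])
    qed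
  qed
next
  case (snoc i W)
  then obtain x a where i: "i = (x, a)" "x \<in> B" "a \<in> C" by auto
  obtain F where F: "lin sTA (*) F"
    "\<And>W'. W' \<in> lists (B \<times> C) \<Longrightarrow> W' \<noteq> [] \<Longrightarrow> F (lprod (map (\<lambda>(x, a). letter x a) W')) = (if W' = W then 1 else 0)"
    using snoc by auto
  obtain D where D: "lin sTA sTA D" "\<And>x a. D (letter x a) = 0"
      "\<And>p y b. D (p \<star> letter y b) = sTA (\<psi> x y * \<beta> a b) p"
    by (rule dual_step[OF inj \<psi>(1)[of x] \<beta>(1)[of a]]) blast
  show ?case
  proof (intro exI conjI ballI impI)
    show "lin sTA (*) (\<lambda>p. F (D p))" by (rule lin_compose[OF D(1) F(1)])
    fix W' assume W': "W' \<in> lists (B \<times> C)" "W' \<noteq> []"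
    from W'(2) obtain V y b where V: "W' = V @ [(y, b)]" by (metis rev_exhaust surj_pair)
    show "F (D (lprod (map (\<lambda>(x, a). letter x a) W'))) = (if W' = W @ [i] then 1 else 0)"
    proof (cases "V = []")
      case True
      then show ?thesis using V snoc.hyps by (simp add: D lin_zero[OF F(1)])
    next
      case False
      then show ?thesis using V W' i F(2)[of V] \<psi>(2) \<beta>(2)
        by (auto simp: lprod_snoc D lin_scale[OF F(1)])
    qed
  qed
qed

text \<open>With \<open>U\<close> = \<open>VA\<close> and \<open>g\<close> = \<open>lprod\<close>,
  the kernel of evaluation must be the span of \<open>R\<close>. Multilinearity of products gives
  one inclusion. For the other, a kernel element is split into a part in the span of
  \<open>R\<close> and a combination of basis words; the latter evaluates to 0 as well, and the dual
  functionals force it to vanish.\<close>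

lemma free_if_inj:
  assumes inj: "inj \<Phi>"
  shows "free_nonunital_algebra sTA str S"
proof -
  obtain B \<psi> where B: "module.span sV B = UNIV" and \<psi>: "\<And>x. lin sV (*) (\<psi> x)"
    "\<And>x y. x \<in> B \<Longrightarrow> y \<in> B \<Longrightarrow> \<psi> x y = (if y = x then 1 else 0)"
    by (rule dual_basis_exists[OF vsV]) blast
  obtain C \<beta> where C: "module.span sA C = UNIV" and \<beta>: "\<And>a. lin sA (*) (\<beta> a)"
    "\<And>a b. a \<in> C \<Longrightarrow> b \<in> C \<Longrightarrow> \<beta> a b = (if b = a then 1 else 0)"
    by (rule dual_basis_exists[OF vsA]) blast
  define \<iota> where "\<iota> = (\<lambda>(x, a). letter x a)"
  define R where "R = (\<Union>us\<in>lists VA. \<Union>vs\<in>lists VA. slot_relations sTA VA (\<lambda>u. us @ u # vs))"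
  define E where "E = (\<lambda>W. Poly_Mapping.single (map \<iota> W) (1::'k)) ` (lists (B \<times> C) - {[]})"
  let ?X = "lists VA - {[]}"
  have functional: "\<exists>F. lin sTA (*) F \<and> (\<forall>W'\<in>lists (B \<times> C). W' \<noteq> [] \<longrightarrow>
      F (lprod (map \<iota> W')) = (if W' = W then 1 else 0))"
    if "W \<in> lists (B \<times> C)" "W \<noteq> []" for W
    unfolding \<iota>_def by (rule word_functional[OF inj \<psi> \<beta> that])
  interpret lc: Vector_Spaces.linear free_scale sTA "lincomb sTA lprod"
    by (rule lincomb_linear[OF vsTA])
  have \<iota>_VA: "\<iota> i \<in> VA" for i by (simp add: \<iota>_def letter_VA split: prod.split)
  have VA_span: "u \<in> TA.span (\<iota> ` (B \<times> C))" if "u \<in> VA" for u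
  proof -
    have "\<iota> ` (B \<times> C) = {letter x a | x a. x \<in> B \<and> a \<in> C}"
      by (auto simp: \<iota>_def)
    moreover have "letter x a \<in> TA.span {letter x a | x a. x \<in> B \<and> a \<in> C}" for x a
      by (rule bilinear_span[OF letter_lin1 tTA_lin2 B C])
    ultimately have "letter x a \<in> TA.span (\<iota> ` (B \<times> C))" for x a
      by (simp only:)
    then have "VA \<subseteq> TA.span (\<iota> ` (B \<times> C))"
      by (rule VA_subsetI[OF TA.subspace_span])
    then show ?thesis using that by blast
  qed
  have kerR: "lincomb sTA lprod r = 0" if "r \<in> R" for r
  proof -
    have "\<forall>r\<in>slot_relations sTA VA (\<lambda>u. us @ u # vs). lincomb sTA lprod r = 0" for us vs
      unfolding slot_relations_iff[OF vsTA]
      using lin_add[OF lprod_slot[of us vs]] lin_scale[OF lprod_slot[of us vs]] by simp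
    then show ?thesis using that by (auto simp: R_def)
  qed
  have keysR: "Poly_Mapping.keys r \<subseteq> ?X" if r: "r \<in> R" for r
  proof -
    let ?K = "{p :: 'ta list \<Rightarrow>\<^sub>0 'k. Poly_Mapping.keys p \<subseteq> ?X}"
    obtain us vs where us: "us \<in> lists VA" "vs \<in> lists VA"
        and r: "r \<in> slot_relations sTA VA (\<lambda>u. us @ u # vs)"
      using r by (auto simp: R_def)
    have K: "Poly_Mapping.single (us @ u # vs) c \<in> ?K" if "u \<in> VA" for u c
      using us that by (auto split: if_splits)
    from r consider u v where "u \<in> VA" "v \<in> VA" "r = Poly_Mapping.single (us @ (u + v) # vs) 1
          - Poly_Mapping.single (us @ u # vs) 1 - Poly_Mapping.single (us @ v # vs) 1"
      | c u where "u \<in> VA"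
          "r = Poly_Mapping.single (us @ sTA c u # vs) 1 - Poly_Mapping.single (us @ u # vs) c"
      unfolding slot_relations_def by blast
    then have "r \<in> ?K"
    proof cases
      case 1
      with K TA.subspace_add[OF subspace_VA] show ?thesis
        by (simp only:) (intro free.subspace_diff[OF subspace_keys] K; simp)
    next
      case 2
      with K TA.subspace_scale[OF subspace_VA] show ?thesis
        by (simp only:) (intro free.subspace_diff[OF subspace_keys] K; simp)
    qed
    then show ?thesis by simp
  qed
  \<comment> \<open>Letters are expanded from the right: the suffix \<open>map \<iota> W\<close>
    already consists of basis letters and must stay general in the induction. For a fixed context,
    the letters whose word lies in the span form a subspace containing all basis letters, hence all
    of \<open>VA\<close>.\<close>
  have reduce: "Poly_Mapping.single (us @ map \<iota> W) 1 \<in> free.span (R \<union> E)"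
    if "us \<in> lists VA" "W \<in> lists (B \<times> C)" "us @ map \<iota> W \<noteq> []" for us W
    using that
  proof (induction us arbitrary: W rule: rev_induct)
    case Nil
    then show ?case by (auto simp: E_def intro!: free.span_base)
  next
    case (snoc u us)
    let ?h = "\<lambda>u. us @ u # map \<iota> W"
    let ?s = "\<lambda>u. Poly_Mapping.single (?h u) (1::'k)"
    let ?Q = "free.span (R \<union> E)"
    have sR: "slot_relations sTA VA ?h \<subseteq> ?Q"
    proof -
      have "map \<iota> W \<in> lists VA" using \<iota>_VA by auto
      then have "slot_relations sTA VA ?h \<subseteq> R" using snoc.prems unfolding R_def by auto
      then show ?thesis using free.span_superset by blast
    qed
    have sc: "?s (sTA c v) \<in> ?Q" if "v \<in> VA" "?s v \<in> ?Q" for c v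
    proof -
      have "?s (sTA c v) - Poly_Mapping.single (?h v) c \<in> ?Q"
        using sR that(1) unfolding slot_relations_def by blast
      moreover have "Poly_Mapping.single (?h v) c = free_scale c (?s v)"
        by (rule poly_mapping_eqI) (simp add: lookup_single when_def)
      ultimately show ?thesis
        using free.span_add[OF _ free.span_scale[OF that(2), of c]] by fastforce
    qed
    have ad: "?s (v + v') \<in> ?Q" if "v \<in> VA" "v' \<in> VA" "?s v \<in> ?Q" "?s v' \<in> ?Q" for v v'
    proof -
      have "?s (v + v') - ?s v - ?s v' \<in> ?Q"
        using sR that(1,2) unfolding slot_relations_def by blast
      from free.span_add[OF free.span_add[OF this that(4)] that(3)] show ?thesis by simp
    qed
    have "TA.subspace {v \<in> VA. ?s v \<in> ?Q}"
    proof (rule TA.subspaceI)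
      have "0 \<in> VA" using subspace_VA by (rule TA.subspace_0)
      \<comment> \<open>In the relation for the scalar 0 the second term has coefficient 0, so the
        word with the letter 0 itself lies in the span.\<close>
      moreover have "?s (sTA 0 0) - Poly_Mapping.single (?h 0) 0 \<in> ?Q"
        using sR calculation unfolding slot_relations_def by blast
      then have "?s 0 \<in> ?Q" by simp
      ultimately show "0 \<in> {v \<in> VA. ?s v \<in> ?Q}" by simp
    qed (use sc ad subspace_VA in \<open>auto intro: TA.subspace_add TA.subspace_scale\<close>)
    moreover have "\<iota> i \<in> {v \<in> VA. ?s v \<in> ?Q}" if "i \<in> B \<times> C" for i
      using snoc.IH[of "i # W"] snoc.prems that \<iota>_VA by auto
    ultimately have "TA.span (\<iota> ` (B \<times> C)) \<subseteq> {v \<in> VA. ?s v \<in> ?Q}"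
      by (intro TA.span_minimal) auto
    then show ?case using VA_span[of u] snoc.prems by auto
  qed
  have dual: "\<exists>F. lin sTA (*) F \<and> (\<forall>e\<in>free.span E. F (lincomb sTA lprod e) = Poly_Mapping.lookup e (map \<iota> W))"
    if W: "W \<in> lists (B \<times> C)" "W \<noteq> []" for W
  proof -
    \<comment> \<open>That different basis words are different lists of elements also follows from
      the dual functional, which takes the value 1 on \<open>W\<close> and 0 on any other.\<close>
    have inj\<iota>: "map \<iota> W' = map \<iota> W \<longleftrightarrow> W' = W" if "W' \<in> lists (B \<times> C)" "W' \<noteq> []" for W'
      using functional[OF W] W that by (metis zero_neq_one)
    from functional[OF W] obtain F where F: "lin sTA (*) F" "\<And>W'. W' \<in> lists (B \<times> C) \<Longrightarrow> W' \<noteq> [] \<Longrightarrow>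
      F (lprod (map \<iota> W')) = (if W' = W then 1 else 0)" by blast
    have "F (lincomb sTA lprod e) = Poly_Mapping.lookup e (map \<iota> W)" if "e \<in> free.span E" for e
      using that
    proof (induction rule: free.span_induct_alt)
      case base
      show ?case by (simp add: lc.zero lin_zero[OF F(1)])
    next
      case (step c x y)
      then obtain W' where W': "W' \<in> lists (B \<times> C)" "W' \<noteq> []" "x = Poly_Mapping.single (map \<iota> W') 1"
        unfolding E_def by blast
      with step show ?case
        by (simp add: lc.add lc.scale lin_add[OF F(1)] lin_scale[OF F(1)] F(2)[OF W'(1,2)] vsTA
            inj\<iota>[OF W'(1,2)] lookup_add lookup_single when_def)
    qed
    with F(1) show ?thesis by blast
  qed
  have kerE: "e = 0" if e: "e \<in> free.span E" and 0: "lincomb sTA lprod e = 0" for e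
  proof (rule ccontr)
    assume "e \<noteq> 0"
    then obtain k where k: "k \<in> Poly_Mapping.keys e" by (metis all_not_in_conv keys_eq_empty)
    \<comment> \<open>A key of \<open>e\<close> is a basis word, and the functional dual to this
      word reads its coefficient off the value of \<open>e\<close>, which is 0.\<close>
    have "E \<subseteq> {p. Poly_Mapping.keys p \<subseteq> map \<iota> ` (lists (B \<times> C) - {[]})}"
      by (auto simp: E_def)
    from free.span_minimal[OF this subspace_keys] e k
    obtain W where W: "W \<in> lists (B \<times> C)" "W \<noteq> []" "k = map \<iota> W" by blast
    from dual[OF W(1,2)] e 0 have "Poly_Mapping.lookup e k = 0"
      using lin_zero W(3) by metis
    with k show False by (simp add: in_keys_iff)
  qed
  have kernel: "{p. Poly_Mapping.keys p \<subseteq> ?X \<and> lincomb sTA lprod p = 0} = free.span R"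
  proof
    have "free.subspace {p. Poly_Mapping.keys p \<subseteq> ?X \<and> lincomb sTA lprod p = 0}"
      using free.subspace_inter[OF subspace_keys lc.subspace_kernel] by (simp add: Int_def)
    then show "free.span R \<subseteq> {p. Poly_Mapping.keys p \<subseteq> ?X \<and> lincomb sTA lprod p = 0}"
      using kerR keysR by (intro free.span_minimal) auto
    show "{p. Poly_Mapping.keys p \<subseteq> ?X \<and> lincomb sTA lprod p = 0} \<subseteq> free.span R"
    proof safe
      fix p assume p: "Poly_Mapping.keys p \<subseteq> ?X" "lincomb sTA lprod p = 0"
      have "(\<lambda>us. Poly_Mapping.single us 1) ` ?X \<subseteq> free.span (R \<union> E)"
        using reduce[of _ "[]"] by auto
      then have "p \<in> free.span (R \<union> E)"
        using keys_in_span[OF p(1)] free.span_minimal[OF _ free.subspace_span] by blast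
      then obtain r e where re: "p = r + e" "r \<in> free.span R" "e \<in> free.span E"
        unfolding free.span_Un by blast
      have "lincomb sTA lprod r = 0"
        using re(2) by (induction rule: free.span_induct_alt) (simp_all add: lc.zero lc.add lc.scale kerR)
      then have "lincomb sTA lprod e = 0" using p(2) re(1) by (simp add: lc.add)
      then show "p \<in> free.span R" using kerE[OF re(3)] re(1,2) by simp
    qed
  qed
  have "presents sTA S ?X lprod R"
    unfolding presents_def using vsTA kernel lincomb_image[OF vsTA, of lprod ?X] S_eq_span_lprod by simp
  then show ?thesis
    unfolding free_nonunital_algebra_def R_def
    by (intro exI[of _ VA] exI[of _ lprod] conjI subspace_VA) (auto simp: lprod_append)
qed

end

theorem proposition3p7:
  fixes sA :: "'k::field \<Rightarrow> 'a::ab_group_add \<Rightarrow> 'a"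
    and sV :: "'k \<Rightarrow> 'v::ab_group_add \<Rightarrow> 'v"
    and sAA :: "'k \<Rightarrow> 'aa::ab_group_add \<Rightarrow> 'aa" and tAA :: "'a \<times> 'a \<Rightarrow> 'aa"
    and sA3 :: "'k \<Rightarrow> 'aaa::ab_group_add \<Rightarrow> 'aaa" and tA3 :: "'a \<times> 'a \<times> 'a \<Rightarrow> 'aaa"
    and sT :: "'k \<Rightarrow> 't::ab_group_add \<Rightarrow> 't" and w :: "'a list \<times> 'v list \<Rightarrow> 't"
    and sTA :: "'k \<Rightarrow> 'ta::ab_group_add \<Rightarrow> 'ta" and tTA :: "'t \<times> 'a \<Rightarrow> 'ta"
    and \<Phi> :: "'aa \<Rightarrow> 'aa"
  assumes "vector_space sA" and "vector_space sV"
    and "tensor_product sA sA sAA tAA"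
    and "tensor_cube sA sA3 tA3"
    and "TAV sA sV sT w"
    and "tensor_product sT sA sTA tTA"
    and "lEAS sAA tAA sA3 tA3 \<Phi>"
    and "\<exists>x::'v. x \<noteq> 0"
  shows "(generated_subalgebra sTA (star sAA tAA sT w sTA tTA \<Phi>) (V_tensor_A w sTA tTA) = UNIV
            \<longleftrightarrow> surj \<Phi>) \<and>
         (free_nonunital_algebra sTA (star sAA tAA sT w sTA tTA \<Phi>)
              (generated_subalgebra sTA (star sAA tAA sT w sTA tTA \<Phi>) (V_tensor_A w sTA tTA))
            \<longleftrightarrow> inj \<Phi>)"
proof -
  interpret leas_setting sA sV sAA tAA sA3 tA3 sT w sTA tTA \<Phi>
    by (intro leas_setting.intro assms(1-7))
  obtain x0 :: 'v where x0: "x0 \<noteq> 0" using assms(8) by blast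
  show ?thesis
    using surj_if_generated[OF x0] generated_if_surj inj_if_free[OF x0] free_if_inj by blast
qed

end
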